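(* For a family of index sequences $\lambda(k)$ depending on $k$, write $S_{\lambda(k)}=\sum_{k\ge0}s_{\lambda(k)}\,t^k$. Then $$t\cdot\left(S_{(k+1,k)}S_{(k+2,k)}-S_{(k,k)}S_{(k+3,k)}\right)-S_{(k,k)}S_{(k+1,k)}=\sum_{0\le b\le a}s_{(a+1,a+1,b+1,b+1,1)}\,t^{a+b+2}-e_1\sum_{0\le b\le a}s_{(a,a,b,b)}\,t^{a+b}$$ and $$S_{(k,k)}S_{(k,k,2,2)}-S_{(k,k,1,1)}^2+S_{(k,k,1)}S_{(k,k,1,1,1)}=\sum_{0\le b\le a}s_{(a+2,a+2,b+2,b+2,2)}\,t^{a+b+3},$$ where the sums on the right are over all pairs of integers $0\le b\le a$.
   Context: $s_\lambda$ is the Schur function (in infinitely many variables) indexed by $\lambda$, with $s_\varnothing=1$; trailing zero parts are ignored, and $s_\lambda=0$ whenever $\lambda$ is not a valid partition (e.g. $s_{(k,k,2,2)}=0$ for $k<2$, $s_{(k,k,1)}=0$ for $k=0$). $e_1=s_{(1)}$ is the first elementary symmetric function. In $S_{\lambda(k)}$ the letter $k$ is the bound summation index. The identities are in the ring of formal power series in $t$ with coefficients in the ring of symmetric functions over $\mathbb Q$. *)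

theory Defs
  imports "HOL-Library.Multiset" "HOL-Library.FuncSet"
    "HOL-Computational_Algebra.Formal_Power_Series"
begin

section \<open>Power series over \<open>\<rat>\<close> in infinitely many variables\<close>

text \<open>
  A monomial in the variables \<open>x\<^sub>0, x\<^sub>1, x\<^sub>2, \<dots>\<close> is encoded as the finite multiset of the indices of
  its variables, so that multiset union is the product of monomials and \<open>p \<subseteq># m\<close> is divisibility.
  The ring of symmetric functions over \<open>\<rat>\<close> is the subring of those series that have bounded degree
  and are invariant under permutations of the variables.
\<close>

typedef mfps = "UNIV :: (nat multiset \<Rightarrow> rat) set"
  morphisms mcoeff Abs_mfps by simp

setup_lifting type_definition_mfps

lemma mcoeff_Abs_mfps [simp]: "mcoeff (Abs_mfps f) = f"
  by (simp add: Abs_mfps_inverse)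

lemma mfps_eqI: "(\<And>m. mcoeff f m = mcoeff g m) \<Longrightarrow> f = g"
  by (metis ext mcoeff_inject)

lemma finite_submsets: "finite {p. p \<subseteq># (m :: 'a multiset)}"
proof (induction m)
  case empty
  then show ?case by simp
next
  case (add x m)
  have "{p. p \<subseteq># add_mset x m} \<subseteq> {p. p \<subseteq># m} \<union> add_mset x ` {p. p \<subseteq># m}"
  proof
    fix p assume "p \<in> {p. p \<subseteq># add_mset x m}"
    then have p: "p \<subseteq># add_mset x m" by simp
    show "p \<in> {p. p \<subseteq># m} \<union> add_mset x ` {p. p \<subseteq># m}"
    proof (cases "x \<in># p")
      case True
      then obtain q where "p = add_mset x q" by (metis insert_DiffM)
      with p show ?thesis by auto
    next
      case False
      with p have "p \<subseteq># m"
        by (metis add_mset_remove_trivial diff_single_trivial subset_eq_diff_conv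
            add_mset_add_single)
      then show ?thesis by simp
    qed
  qed
  with add.IH show ?case by (meson finite_UnI finite_imageI finite_subset)
qed

instantiation mfps :: comm_ring_1
begin

lift_definition zero_mfps :: mfps is "\<lambda>m. 0" .
lift_definition one_mfps :: mfps is "\<lambda>m. if m = {#} then 1 else 0" .
lift_definition plus_mfps :: "mfps \<Rightarrow> mfps \<Rightarrow> mfps" is "\<lambda>f g m. f m + g m" .
lift_definition minus_mfps :: "mfps \<Rightarrow> mfps \<Rightarrow> mfps" is "\<lambda>f g m. f m - g m" .
lift_definition uminus_mfps :: "mfps \<Rightarrow> mfps" is "\<lambda>f m. - f m" .
lift_definition times_mfps :: "mfps \<Rightarrow> mfps \<Rightarrow> mfps"
  is "\<lambda>f g m. \<Sum>p | p \<subseteq># m. f p * g (m - p)" .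

instance
proof
  fix a b c :: mfps
  show "a * b * c = a * (b * c)"
  proof (rule mfps_eqI)
    fix m
    have "mcoeff (a * b * c) m =
        (\<Sum>p | p \<subseteq># m. \<Sum>q | q \<subseteq># p. mcoeff a q * mcoeff b (p - q) * mcoeff c (m - p))"
      by (simp add: times_mfps.rep_eq sum_distrib_right)
    also have "\<dots> = (\<Sum>(p, q) \<in> (SIGMA p:{p. p \<subseteq># m}. {q. q \<subseteq># p}).
        mcoeff a q * mcoeff b (p - q) * mcoeff c (m - p))"
      by (rule sum.Sigma) (auto simp: finite_submsets)
    also have "\<dots> = (\<Sum>(q, r) \<in> (SIGMA q:{q. q \<subseteq># m}. {r. r \<subseteq># m - q}).
        mcoeff a q * (mcoeff b r * mcoeff c (m - q - r)))"
    proof (rule sum.reindex_bij_witness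
        [where i = "\<lambda>(q, r). (q + r, q)" and j = "\<lambda>(p, q). (q, p - q)"])
      fix z assume "z \<in> (SIGMA p:{p. p \<subseteq># m}. {q. q \<subseteq># p})"
      then obtain p q where z: "z = (p, q)" and p: "p \<subseteq># m" and q: "q \<subseteq># p" by auto
      from p q have "q \<subseteq># m" by (rule subset_mset.order_trans[rotated])
      moreover from p have "p - q \<subseteq># m - q"
        by (simp add: subseteq_mset_def diff_le_mono)
      moreover from q have "q + (p - q) = p" by simp
      moreover from \<open>q + (p - q) = p\<close> have "m - q - (p - q) = m - p"
        by (metis diff_diff_add_mset)
      ultimately show "(case case z of (p, q) \<Rightarrow> (q, p - q) of (q, r) \<Rightarrow> (q + r, q)) = z"
        and "(case z of (p, q) \<Rightarrow> (q, p - q)) \<in> (SIGMA q:{q. q \<subseteq># m}. {r. r \<subseteq># m - q})"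
        and "(case case z of (p, q) \<Rightarrow> (q, p - q) of (q, r) \<Rightarrow>
              mcoeff a q * (mcoeff b r * mcoeff c (m - q - r))) =
            (case z of (p, q) \<Rightarrow> mcoeff a q * mcoeff b (p - q) * mcoeff c (m - p))"
        by (auto simp: z mult.assoc)
    next
      fix z assume "z \<in> (SIGMA q:{q. q \<subseteq># m}. {r. r \<subseteq># m - q})"
      then show "(case z of (q, r) \<Rightarrow> (q + r, q)) \<in> (SIGMA p:{p. p \<subseteq># m}. {q. q \<subseteq># p})"
        by (auto simp: subset_mset.le_diff_conv2 add.commute)
    qed auto
    also have "\<dots> = (\<Sum>q | q \<subseteq># m. \<Sum>r | r \<subseteq># m - q.
        mcoeff a q * (mcoeff b r * mcoeff c (m - q - r)))"
      by (rule sum.Sigma[symmetric]) (auto simp: finite_submsets)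
    also have "\<dots> = mcoeff (a * (b * c)) m"
      by (simp add: times_mfps.rep_eq sum_distrib_left)
    finally show "mcoeff (a * b * c) m = mcoeff (a * (b * c)) m" .
  qed
  show "a * b = b * a"
  proof (rule mfps_eqI)
    fix m
    show "mcoeff (a * b) m = mcoeff (b * a) m"
      unfolding times_mfps.rep_eq
      by (rule sum.reindex_bij_witness[where i = "\<lambda>p. m - p" and j = "\<lambda>p. m - p"])
        (auto simp: mult.commute double_diff subset_mset.diff_diff_right)
  qed
  show "1 * a = a"
  proof (rule mfps_eqI)
    fix m
    have "mcoeff (1 * a) m = (\<Sum>p | p \<subseteq># m. if p = {#} then mcoeff a m else 0)"
      unfolding times_mfps.rep_eq one_mfps.rep_eq by (rule sum.cong) auto
    also have "\<dots> = mcoeff a m"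
      by (subst sum.delta) (auto simp: finite_submsets)
    finally show "mcoeff (1 * a) m = mcoeff a m" .
  qed
  show "(a + b) * c = a * c + b * c"
    by (rule mfps_eqI)
      (simp add: times_mfps.rep_eq plus_mfps.rep_eq distrib_right sum.distrib)
  show "a + b + c = a + (b + c)" "a + b = b + a" "0 + a = a" "- a + a = 0" "a - b = a + - b"
    by (transfer; simp add: fun_eq_iff)+
  show "(0 :: mfps) \<noteq> 1"
    by transfer (metis one_neq_zero)
qed

end

section \<open>Schur functions\<close>

text \<open>
  An index sequence is a list of naturals. It is a partition, possibly with trailing zeros, iff it is
  weakly decreasing. Rows and columns of the diagram are numbered from 0.
\<close>

definition is_partition :: "nat list \<Rightarrow> bool" where
  "is_partition la \<longleftrightarrow> sorted_wrt (\<ge>) la"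

definition cells :: "nat list \<Rightarrow> (nat \<times> nat) set" where
  "cells la = (SIGMA i:{..<length la}. {..<la ! i})"

text \<open>Tableaux are extensional functions, so that each one is counted once.\<close>

definition ssyt :: "nat list \<Rightarrow> (nat \<times> nat \<Rightarrow> nat) set" where
  "ssyt la = {T \<in> cells la \<rightarrow>\<^sub>E UNIV.
     (\<forall>i j. (i, j) \<in> cells la \<longrightarrow> (i, Suc j) \<in> cells la \<longrightarrow> T (i, j) \<le> T (i, Suc j)) \<and>
     (\<forall>i j. (i, j) \<in> cells la \<longrightarrow> (Suc i, j) \<in> cells la \<longrightarrow> T (i, j) < T (Suc i, j))}"

definition content :: "nat list \<Rightarrow> (nat \<times> nat \<Rightarrow> nat) \<Rightarrow> nat multiset" where
  "content la T = image_mset T (mset_set (cells la))"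

definition schur :: "nat list \<Rightarrow> mfps" where
  "schur la = (if is_partition la
     then Abs_mfps (\<lambda>m. of_nat (card {T \<in> ssyt la. content la T = m}))
     else 0)"

definition elem_sym :: "nat \<Rightarrow> mfps" where
  "elem_sym d = Abs_mfps (\<lambda>m. if size m = d \<and> (\<forall>i. count m i \<le> 1) then 1 else 0)"

lemma finite_cells [simp]: "finite (cells la)"
  by (simp add: cells_def)

lemma finite_ssyt_content: "finite {T \<in> ssyt la. content la T = m}"
proof (rule finite_subset)
  show "{T \<in> ssyt la. content la T = m} \<subseteq> cells la \<rightarrow>\<^sub>E set_mset m"
    by (auto simp: ssyt_def content_def PiE_iff extensional_def)
  show "finite (cells la \<rightarrow>\<^sub>E set_mset m)"
    by (rule finite_PiE) auto
qed

lemma schur_Nil: "schur [] = 1"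
proof -
  have "{T \<in> ssyt []. content [] T = m} = (if m = {#} then {\<lambda>_. undefined} else {})" for m
    by (auto simp: ssyt_def content_def cells_def)
  then show ?thesis
    by (intro mfps_eqI) (simp add: schur_def is_partition_def one_mfps.rep_eq)
qed

lemma schur_append_zero:
  "schur (la @ [0]) = schur la"
proof -
  have c: "cells (la @ [0]) = cells la"
    by (auto simp: cells_def nth_append less_Suc_eq split: if_splits)
  have "is_partition (la @ [0]) = is_partition la"
    by (auto simp: is_partition_def sorted_wrt_append)
  with c show ?thesis by (simp add: schur_def ssyt_def content_def)
qed

lemma elem_sym_1: "elem_sym 1 = schur [1]"
proof (rule mfps_eqI)
  fix m
  have c: "cells [1] = {(0, 0)}" by (auto simp: cells_def)
  have A: "{T \<in> ssyt [1]. content [1] T = m} = {T \<in> {(0, 0)} \<rightarrow>\<^sub>E UNIV. {#T (0, 0)#} = m}"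
    unfolding ssyt_def content_def c by auto
  have s: "mcoeff (schur [1]) m =
      of_nat (card {T \<in> {(0 :: nat, 0 :: nat)} \<rightarrow>\<^sub>E UNIV. {#T (0, 0)#} = m})"
    by (simp add: schur_def is_partition_def flip: A)
  show "mcoeff (elem_sym 1) m = mcoeff (schur [1]) m"
  proof (cases "size m = 1")
    case True
    then obtain x where m: "m = {#x#}" by (metis size_1_singleton_mset)
    have "{T \<in> {(0 :: nat, 0 :: nat)} \<rightarrow>\<^sub>E UNIV. {#T (0, 0)#} = m} = {restrict (\<lambda>_. x) {(0, 0)}}"
      unfolding m by (auto simp: PiE_iff extensional_def fun_eq_iff)
    then show ?thesis unfolding s by (simp add: elem_sym_def m)
  next
    case False
    then have e: "{T \<in> {(0 :: nat, 0 :: nat)} \<rightarrow>\<^sub>E UNIV. {#T (0, 0)#} = m} = {}" by auto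
    from False show ?thesis
      unfolding s e by (simp add: elem_sym_def)
  qed
qed

definition schur_series :: "(nat \<Rightarrow> nat list) \<Rightarrow> mfps fps" where
  "schur_series la = Abs_fps (\<lambda>k. schur (la k))"

text \<open>
  The formal sum \<open>\<Sum>\<^bsub>0 \<le> b \<le> a\<^esub> c a b * t ^ (a + b + d)\<close>: its coefficient at \<open>t ^ n\<close> collects the
  finitely many pairs with \<open>a + b + d = n\<close>.
\<close>

definition pair_series :: "nat \<Rightarrow> (nat \<Rightarrow> nat \<Rightarrow> mfps) \<Rightarrow> mfps fps" where
  "pair_series d c = Abs_fps (\<lambda>n. \<Sum>(a, b) | b \<le> a \<and> a + b + d = n. c a b)"

lemma finite_pair_series_index: "finite {(a, b). b \<le> a \<and> a + b + d = (n :: nat)}"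
  by (rule finite_subset[of _ "{..n} \<times> {..n}"]) auto

end

theory Submission
  imports Defs "Jordan_Normal_Form.Determinant"
begin

text \<open>
  Everything is expressed through determinants in the complete homogeneous symmetric functions
  \<open>h\<^sub>m\<close>. The Jacobi--Trudi formula \<open>s\<^sub>\<lambda> = det (h (\<lambda>\<^sub>i - i + j))\<close> (lemma \<open>schur_eq_jacobi_trudi\<close>) is
  proved by adding variables one at a time. The cells of a tableau that carry the largest entry form a
  horizontal strip (\<open>schur_branching\<close>), and the determinant obeys the same recursion: subtracting
  multiples of the next row from each row cuts its expansion in the new variable down to horizontal
  strips (\<open>jacobi_trudi_branching\<close>).

  For the identities, two equal parts \<open>(a, a)\<close> contribute the two consecutive rows
  \<open>(h\<^sub>a, h\<^bsub>a+1\<^esub>, \<dots>)\<close> and \<open>(h\<^bsub>a-1\<^esub>, h\<^sub>a, \<dots>)\<close>, each of whose minors is \<open>0\<close> or a Schur function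
  of two rows. Expanding the matrix of \<open>(\<alpha>, \<alpha>, \<beta>, \<beta>)\<close> along its two pairs of rows gives products
  of these. The determinant is a symmetric function of \<open>\<alpha>\<close> and \<open>\<beta> - 2\<close>, since two pairs of rows are
  interchanged by an even permutation, and it vanishes when these arguments differ by at most \<open>1\<close>,
  since then a row is repeated. Therefore, for a fixed value of \<open>\<alpha> + \<beta>\<close>, its sum over
  \<open>\<beta> \<le> \<alpha>\<close> is half of its sum over all pairs of integers, and the latter is a combination of
  products of the series \<open>\<Sum>\<^sub>k s\<^bsub>(k+d,k)\<^esub> t\<^sup>k\<close> (\<open>pair_series_fold\<close>, \<open>pair_series_laplace\<close>).

  A fifth row of length \<open>1\<close> or \<open>2\<close> is removed by expanding along it, since it has few nonzero entries.
  What remains is a polynomial identity between the two-row series and \<open>h\<^sub>1, h\<^sub>2, h\<^sub>3\<close>, together with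
  the boundary terms from index sequences that are not partitions.
\<close>

section \<open>Setting all but finitely many variables to zero\<close>

text \<open>
  The image of a series under \<open>x\<^sub>n = x\<^bsub>n+1\<^esub> = \<dots> = 0\<close>. The Jacobi--Trudi formula is proved by
  adding the variables one at a time, so both sides are compared after this specialisation.
\<close>

definition first_vars :: "nat \<Rightarrow> mfps \<Rightarrow> mfps" where
  "first_vars n f = Abs_mfps (\<lambda>M. if set_mset M \<subseteq> {..<n} then mcoeff f M else 0)"

lemma mcoeff_first_vars:
  "mcoeff (first_vars n f) M = (if set_mset M \<subseteq> {..<n} then mcoeff f M else 0)"
  by (simp add: first_vars_def)

text \<open>
  Each coefficient involves only finitely many variables, so the specialisations separate points.
\<close>

lemma eq_if_first_vars_eq:
  assumes "\<And>n. first_vars n f = first_vars n g"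
  shows "f = g"
proof (rule mfps_eqI)
  fix M :: "nat multiset"
  obtain n where "set_mset M \<subseteq> {..<n}"
    using finite_nat_iff_bounded[of "set_mset M"] by auto
  then show "mcoeff f M = mcoeff g M"
    using arg_cong[OF assms[of n], of "\<lambda>h. mcoeff h M"] by (simp add: mcoeff_first_vars)
qed

lemma first_vars_mult: "first_vars n (f * g) = first_vars n f * first_vars n g"
proof (rule mfps_eqI)
  fix M
  show "mcoeff (first_vars n (f * g)) M = mcoeff (first_vars n f * first_vars n g) M"
  proof (cases "set_mset M \<subseteq> {..<n}")
    case True
    have "set_mset p \<subseteq> {..<n} \<and> set_mset (M - p) \<subseteq> {..<n}" if "p \<subseteq># M" for p
      using that True by (meson diff_subset_eq_self set_mset_mono subset_trans)
    then show ?thesis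
      using True by (auto simp: mcoeff_first_vars times_mfps.rep_eq intro!: sum.cong)
  next
    case False
    have "\<not> (set_mset p \<subseteq> {..<n} \<and> set_mset (M - p) \<subseteq> {..<n})" if "p \<subseteq># M" for p
      using that False by (metis Un_least set_mset_union subset_mset.add_diff_inverse)
    then have "(\<Sum>p | p \<subseteq># M. mcoeff (first_vars n f) p * mcoeff (first_vars n g) (M - p)) = 0"
      by (intro sum.neutral) (auto simp: mcoeff_first_vars)
    with False show ?thesis
      by (simp add: mcoeff_first_vars times_mfps.rep_eq)
  qed
qed

interpretation first_vars: comm_ring_hom "first_vars n"
  by unfold_locales
    (auto intro!: mfps_eqI simp: first_vars_mult mcoeff_first_vars zero_mfps.rep_eq
      plus_mfps.rep_eq one_mfps.rep_eq)

definition monomial :: "nat multiset \<Rightarrow> mfps" where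
  "monomial P = Abs_mfps (\<lambda>M. if M = P then 1 else 0)"

lemma mcoeff_monomial_mult:
  "mcoeff (monomial P * f) M = (if P \<subseteq># M then mcoeff f (M - P) else 0)"
proof -
  have "mcoeff (monomial P * f) M = (\<Sum>p | p \<subseteq># M. if p = P then mcoeff f (M - P) else 0)"
    unfolding times_mfps.rep_eq monomial_def by (rule sum.cong) auto
  also have "\<dots> = (if P \<subseteq># M then mcoeff f (M - P) else 0)"
    by (subst sum.delta) (auto simp: finite_submsets)
  finally show ?thesis .
qed

lemma monomial_empty: "monomial {#} = 1"
  by (rule mfps_eqI) (simp add: monomial_def one_mfps.rep_eq)

lemma monomial_add: "monomial (P + Q) = monomial P * monomial Q"
proof (rule mfps_eqI)
  fix M
  show "mcoeff (monomial (P + Q)) M = mcoeff (monomial P * monomial Q) M"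
    unfolding mcoeff_monomial_mult by (auto simp: monomial_def)
qed

lemma prod_monomial_replicate:
  "finite A \<Longrightarrow> (\<Prod>i\<in>A. monomial (replicate_mset (k i) x)) = monomial (replicate_mset (sum k A) x)"
proof (induction A rule: finite_induct)
  case empty
  then show ?case by (simp add: monomial_empty)
next
  case (insert i A)
  have "replicate_mset (a + b) x = replicate_mset a x + replicate_mset b x" for a b :: nat
    by (rule multiset_eqI) simp
  with insert show ?case by (simp add: monomial_add)
qed

section \<open>Complete homogeneous symmetric functions\<close>

text \<open>
  The degree is an integer because the Jacobi--Trudi matrix also has entries of negative degree,
  which are \<open>0\<close>.
\<close>

definition complete_sym :: "int \<Rightarrow> mfps" where
  "complete_sym m = Abs_mfps (\<lambda>M. if int (size M) = m then 1 else 0)"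

lemma complete_sym_0: "complete_sym 0 = 1"
  by (rule mfps_eqI) (simp add: complete_sym_def one_mfps.rep_eq)

lemma complete_sym_neg: "m < 0 \<Longrightarrow> complete_sym m = 0"
  by (rule mfps_eqI) (simp add: complete_sym_def zero_mfps.rep_eq)

text \<open>
  A monomial in \<open>x\<^sub>0, \<dots>, x\<^sub>n\<close> either avoids \<open>x\<^sub>n\<close> or is \<open>x\<^sub>n\<close> times a monomial of smaller degree.
\<close>

lemma complete_sym_add_var:
  "first_vars (Suc n) (complete_sym m) = first_vars n (complete_sym m)
     + monomial {#n#} * first_vars (Suc n) (complete_sym (m - 1))"
proof (rule mfps_eqI)
  fix M
  show "mcoeff (first_vars (Suc n) (complete_sym m)) M = mcoeff (first_vars n (complete_sym m)
     + monomial {#n#} * first_vars (Suc n) (complete_sym (m - 1))) M"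
  proof (cases "n \<in># M")
    case True
    then obtain M' where M: "M = add_mset n M'" by (metis insert_DiffM)
    show ?thesis
      unfolding plus_mfps.rep_eq mcoeff_monomial_mult mcoeff_first_vars
      by (auto simp: complete_sym_def M)
  next
    case False
    then have "set_mset M \<subseteq> {..<Suc n} \<longleftrightarrow> set_mset M \<subseteq> {..<n}"
      by (auto simp: less_Suc_eq)
    with False show ?thesis
      unfolding plus_mfps.rep_eq mcoeff_monomial_mult mcoeff_first_vars
      by (auto simp: complete_sym_def)
  qed
qed

text \<open>
  The generating series of the \<open>h\<^sub>m\<close> acquires a factor \<open>1 / (1 - x\<^sub>n u)\<close> when \<open>x\<^sub>n\<close> is added; a
  truncated geometric series is the difference of two full ones. The subtracted term will turn out to
  be a multiple of the next row of the Jacobi--Trudi matrix.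
\<close>

lemma complete_sym_truncated_sum:
  "(\<Sum>k<K. monomial (replicate_mset k n) * first_vars n (complete_sym (m - int k)))
     = first_vars (Suc n) (complete_sym m)
       - monomial (replicate_mset K n) * first_vars (Suc n) (complete_sym (m - int K))"
proof (induction K)
  case 0
  then show ?case by (simp add: monomial_empty)
next
  case (Suc K)
  have x: "monomial (replicate_mset (Suc K) n) = monomial (replicate_mset K n) * monomial {#n#}"
    by (simp flip: monomial_add)
  have m: "m - int (Suc K) = m - int K - 1" by simp
  show ?case
    unfolding sum.lessThan_Suc Suc.IH x m complete_sym_add_var[of n "m - int K"]
    by (simp add: algebra_simps)
qed

lemma first_vars_0_complete_sym: "first_vars 0 (complete_sym m) = (if m = 0 then 1 else 0)"
  by (rule mfps_eqI)
    (auto simp: mcoeff_first_vars complete_sym_def one_mfps.rep_eq zero_mfps.rep_eq)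

section \<open>The branching rule for Jacobi--Trudi determinants\<close>

text \<open>
  Multilinearity in all rows at once: choosing one summand in each row.
\<close>

lemma det_rows_sum:
  fixes c :: "nat \<Rightarrow> 'b \<Rightarrow> 'a :: comm_ring_1"
  assumes "\<And>i. i < l \<Longrightarrow> finite (S i)"
  shows "det (mat l l (\<lambda>(i, j). \<Sum>k\<in>S i. c i k * g i k j)) =
    (\<Sum>f\<in>PiE {0..<l} S. (\<Prod>i=0..<l. c i (f i)) * det (mat l l (\<lambda>(i, j). g i (f i) j)))"
proof -
  have p: "p i < l" if "p permutes {0..<l}" "i < l" for p i
    using permutes_in_image[OF that(1), of i] that(2) by simp
  have "det (mat l l (\<lambda>(i, j). \<Sum>k\<in>S i. c i k * g i k j)) =
      (\<Sum>p | p permutes {0..<l}. signof p * (\<Prod>i=0..<l. \<Sum>k\<in>S i. c i k * g i k (p i)))"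
    by (subst det_def'[of _ l]) (auto intro!: sum.cong prod.cong simp: p)
  also have "\<dots> = (\<Sum>p | p permutes {0..<l}. \<Sum>f\<in>PiE {0..<l} S.
      (\<Prod>i=0..<l. c i (f i)) * (signof p * (\<Prod>i=0..<l. g i (f i) (p i))))"
    by (subst prod_sum_PiE) (auto simp: assms sum_distrib_left prod.distrib mult_ac)
  also have "\<dots> = (\<Sum>f\<in>PiE {0..<l} S. \<Sum>p | p permutes {0..<l}.
      (\<Prod>i=0..<l. c i (f i)) * (signof p * (\<Prod>i=0..<l. g i (f i) (p i))))"
    by (rule sum.swap)
  also have "\<dots> = (\<Sum>f\<in>PiE {0..<l} S. (\<Prod>i=0..<l. c i (f i)) * det (mat l l (\<lambda>(i, j). g i (f i) j)))"
    by (subst det_def'[of _ l])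
      (auto intro!: sum.cong prod.cong simp: p simp flip: sum_distrib_left)
  finally show ?thesis .
qed

text \<open>
  All the row operations are done simultaneously, by a left factor that is upper triangular with
  diagonal \<open>1\<close>.
\<close>

lemma det_subtract_next_rows:
  fixes A :: "nat \<Rightarrow> nat \<Rightarrow> 'a :: comm_ring_1"
  shows "det (mat l l (\<lambda>(i, j). A i j - (if Suc i < l then c i * A (Suc i) j else 0)))
    = det (mat l l (\<lambda>(i, j). A i j))"
proof -
  define U where "U = mat l l (\<lambda>(i, k). if k = i then 1 else if k = Suc i then - c i else 0)"
  have U: "U \<in> carrier_mat l l" by (simp add: U_def)
  have "mat l l (\<lambda>(i, j). A i j - (if Suc i < l then c i * A (Suc i) j else 0))
      = U * mat l l (\<lambda>(i, j). A i j)"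
  proof (rule eq_matI, goal_cases)
    case (1 i j)
    then have i: "i < l" and j: "j < l" by (auto simp: U_def)
    have "(\<Sum>k=0..<l. (if k = i then 1 else if k = Suc i then - c i else 0) * A k j) =
        (\<Sum>k=0..<l. (if k = i then A i j else 0) + (if k = Suc i then - c i * A (Suc i) j else 0))"
      by (rule sum.cong) auto
    also have "\<dots> = A i j - (if Suc i < l then c i * A (Suc i) j else 0)"
      using i by (simp add: sum.distrib)
    finally show ?case
      using i j by (simp add: U_def scalar_prod_def)
  qed (auto simp: U_def)
  moreover have "det U = 1"
  proof -
    have "det U = prod_list (diag_mat U)"
      by (rule det_upper_triangular[OF _ U]) (auto simp: U_def upper_triangular_def)
    also have "\<dots> = 1"
      unfolding prod_list_diag_prod by (rule prod.neutral) (auto simp: U_def)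
    finally show ?thesis .
  qed
  ultimately show ?thesis
    by (simp add: det_mult[OF U])
qed

definition jacobi_trudi :: "(int \<Rightarrow> 'a :: comm_ring_1) \<Rightarrow> nat list \<Rightarrow> 'a" where
  "jacobi_trudi h la = det (mat (length la) (length la)
     (\<lambda>(i, j). h (int (la ! i) - int i + int j)))"

text \<open>
  The list is padded by a part \<open>0\<close>, so that the last row of a horizontal strip is bounded below
  by \<open>0\<close>.
\<close>

definition next_part :: "nat list \<Rightarrow> nat \<Rightarrow> nat" where
  "next_part la i = (if Suc i < length la then la ! Suc i else 0)"

text \<open>
  The row lengths of the diagrams \<open>\<mu> \<subseteq> \<lambda>\<close> for which \<open>\<lambda> / \<mu>\<close> is a horizontal strip, that is,
  has at most one cell in each column. They are extensional functions because the expansion of a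
  product of sums is indexed by such functions.
\<close>

definition strips :: "nat list \<Rightarrow> (nat \<Rightarrow> nat) set" where
  "strips la = (\<Pi>\<^sub>E i\<in>{0..<length la}. {next_part la i..la ! i})"

lemma next_part_le:
  assumes "is_partition la" "i < length la"
  shows "next_part la i \<le> la ! i"
  using assms by (auto simp: next_part_def is_partition_def sorted_wrt_iff_nth_less)

text \<open>
  Row \<open>i\<close> of the determinant may be replaced by itself minus a multiple of row \<open>i + 1\<close>. With the
  multiplier \<open>x\<^sub>n\<close> to the power \<open>\<lambda>\<^sub>i - \<lambda>\<^bsub>i+1\<^esub> + 1\<close> this truncates the sum over the powers of \<open>x\<^sub>n\<close> in
  row \<open>i\<close> exactly at those \<open>\<mu>\<^sub>i\<close> that a horizontal strip permits. Multilinearity then sums over the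
  strips.
\<close>

lemma jacobi_trudi_branching:
  assumes la: "is_partition la"
  shows "jacobi_trudi (\<lambda>m. first_vars (Suc n) (complete_sym m)) la =
    (\<Sum>f\<in>strips la. monomial (replicate_mset (\<Sum>i=0..<length la. la ! i - f i) n) *
      jacobi_trudi (\<lambda>m. first_vars n (complete_sym m)) (map f [0..<length la]))"
proof -
  define l where "l = length la"
  define h where "h = (\<lambda>m. first_vars n (complete_sym m))"
  define H where "H = (\<lambda>m. first_vars (Suc n) (complete_sym m))"
  define c where "c = (\<lambda>i. monomial (replicate_mset (Suc (la ! i - next_part la i)) n))"
  have row: "(\<Sum>k\<in>{next_part la i..la ! i}.
        monomial (replicate_mset (la ! i - k) n) * h (int k - int i + int j)) =
      H (int (la ! i) - int i + int j) -
        (if Suc i < l then c i * H (int (la ! Suc i) - int (Suc i) + int j) else 0)"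
    if "i < l" "j < l" for i j
  proof -
    have le: "next_part la i \<le> la ! i" using next_part_le la that by (simp add: l_def)
    have "(\<Sum>k\<in>{next_part la i..la ! i}.
        monomial (replicate_mset (la ! i - k) n) * h (int k - int i + int j)) =
      (\<Sum>k<Suc (la ! i - next_part la i).
        monomial (replicate_mset k n) * h (int (la ! i) - int i + int j - int k))"
      by (rule sum.reindex_bij_witness[where i = "\<lambda>k. la ! i - k" and j = "\<lambda>k. la ! i - k"])
        (use le in \<open>auto simp: of_nat_diff algebra_simps\<close>)
    also have "\<dots> = H (int (la ! i) - int i + int j) -
        c i * H (int (next_part la i) - int (Suc i) + int j)"
      unfolding h_def complete_sym_truncated_sum H_def c_def
      using le by (simp add: of_nat_diff algebra_simps)
    also have "c i * H (int (next_part la i) - int (Suc i) + int j) =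
        (if Suc i < l then c i * H (int (la ! Suc i) - int (Suc i) + int j) else 0)"
    proof (cases "Suc i < l")
      case True
      then show ?thesis by (simp add: next_part_def l_def)
    next
      case False
      \<comment> \<open>In the last row \<open>next_part\<close> is \<open>0\<close> and \<open>j \<le> i\<close>, so the degree is negative.\<close>
      have "H (int (next_part la i) - int (Suc i) + int j) = 0"
        using False that by (simp add: next_part_def l_def H_def complete_sym_neg)
      with False show ?thesis by simp
    qed
    finally show ?thesis .
  qed
  have "jacobi_trudi H la = det (mat l l (\<lambda>(i, j). H (int (la ! i) - int i + int j) -
      (if Suc i < l then c i * H (int (la ! Suc i) - int (Suc i) + int j) else 0)))"
    using det_subtract_next_rows[of l "\<lambda>i j. H (int (la ! i) - int i + int j)" c]
    by (simp add: jacobi_trudi_def l_def)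
  also have "\<dots> = det (mat l l (\<lambda>(i, j). \<Sum>k\<in>{next_part la i..la ! i}.
        monomial (replicate_mset (la ! i - k) n) * h (int k - int i + int j)))"
    by (intro arg_cong[where f = det] cong_mat) (auto simp: row)
  also have "\<dots> = (\<Sum>f\<in>strips la.
      (\<Prod>i=0..<l. monomial (replicate_mset (la ! i - f i) n)) *
      det (mat l l (\<lambda>(i, j). h (int (f i) - int i + int j))))"
    unfolding strips_def l_def by (rule det_rows_sum) auto
  also have "\<dots> = (\<Sum>f\<in>strips la. monomial (replicate_mset (\<Sum>i=0..<l. la ! i - f i) n) *
      jacobi_trudi h (map f [0..<l]))"
    by (rule sum.cong)
      (auto simp: prod_monomial_replicate jacobi_trudi_def intro!: arg_cong[where f = det]
        arg_cong2[where f = "(*)"] cong_mat)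
  finally show ?thesis unfolding h_def H_def l_def .
qed

section \<open>The branching rule for semistandard tableaux\<close>

lemma mem_cells: "(i, j) \<in> cells la \<longleftrightarrow> i < length la \<and> j < la ! i"
  by (simp add: cells_def)

lemma mem_cells_map: "(i, j) \<in> cells (map f [0..<l]) \<longleftrightarrow> i < l \<and> j < f i"
  by (auto simp: cells_def)

lemma card_cells: "card (cells la) = (\<Sum>i=0..<length la. la ! i)"
  by (simp add: cells_def lessThan_atLeast0)

lemma stripsD:
  assumes "f \<in> strips la" "i < length la"
  shows "next_part la i \<le> f i" "f i \<le> la ! i"
  using assms by (auto simp: strips_def PiE_iff)

lemma is_partition_strip:
  assumes "is_partition la" "f \<in> strips la"
  shows "is_partition (map f [0..<length la])"
proof -
  have le: "f j \<le> f i" if "i < j" "j < length la" for i j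
  proof -
    have "f j \<le> la ! j" using stripsD assms that by blast
    also have "la ! j \<le> la ! Suc i"
      using assms(1) that unfolding is_partition_def sorted_wrt_iff_nth_less
      by (cases "j = Suc i") auto
    also have "\<dots> = next_part la i" using that by (simp add: next_part_def)
    also have "\<dots> \<le> f i" using stripsD[OF assms(2), of i] that by simp
    finally show ?thesis .
  qed
  then show ?thesis by (simp add: is_partition_def sorted_wrt_iff_nth_less)
qed

lemma cells_strip_subset:
  assumes "f \<in> strips la"
  shows "cells (map f [0..<length la]) \<subseteq> cells la"
  using stripsD(2)[OF assms] by (fastforce simp: cells_def)

lemma content_extend_strip:
  assumes f: "f \<in> strips la"
    and in_mu: "\<And>c. c \<in> cells (map f [0..<length la]) \<Longrightarrow> T c = T' c"
    and out_mu: "\<And>c. c \<in> cells la - cells (map f [0..<length la]) \<Longrightarrow> T c = n"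
  shows "Defs.content la T = Defs.content (map f [0..<length la]) T'
    + replicate_mset (\<Sum>i=0..<length la. la ! i - f i) n"
proof -
  define mu where "mu = map f [0..<length la]"
  have sub: "cells mu \<subseteq> cells la" unfolding mu_def by (rule cells_strip_subset[OF f])
  have "card (cells la - cells mu) = (\<Sum>i=0..<length la. la ! i) - (\<Sum>i=0..<length la. f i)"
    by (simp add: card_Diff_subset sub card_cells) (simp add: mu_def)
  also have "\<dots> = (\<Sum>i=0..<length la. la ! i - f i)"
    using stripsD(2)[OF f] by (subst sum_subtractf_nat) auto
  finally have card: "card (cells la - cells mu) = (\<Sum>i=0..<length la. la ! i - f i)" .
  have "mset_set (cells la) = mset_set (cells mu) + mset_set (cells la - cells mu)"
    using sub by (metis Diff_disjoint Diff_partition finite_Diff finite_cells mset_set_Union)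
  then have "Defs.content la T = image_mset T (mset_set (cells mu))
      + image_mset T (mset_set (cells la - cells mu))"
    by (simp add: Defs.content_def)
  also have "image_mset T (mset_set (cells mu)) = Defs.content mu T'"
    unfolding Defs.content_def by (rule image_mset_cong) (auto simp: in_mu mu_def)
  also have "image_mset T (mset_set (cells la - cells mu))
      = image_mset (\<lambda>_. n) (mset_set (cells la - cells mu))"
    by (rule image_mset_cong) (auto simp: out_mu mu_def)
  also have "\<dots> = replicate_mset (\<Sum>i=0..<length la. la ! i - f i) n"
    by (simp add: image_mset_const_eq card)
  finally show ?thesis by (simp add: mu_def)
qed

lemma set_mset_content: "set_mset (Defs.content la T) = T ` cells la"
  by (simp add: Defs.content_def)

lemma downclosed_nat_set:
  assumes "finite D" "\<And>j k. j \<in> D \<Longrightarrow> k < j \<Longrightarrow> k \<in> (D :: nat set)"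
  shows "D = {..<card D}"
proof -
  obtain m where m: "m \<notin> D" and least: "\<And>k. k < m \<Longrightarrow> k \<in> D"
    using exists_least_iff[of "\<lambda>m. m \<notin> D"] ex_new_if_finite[OF infinite_UNIV_nat assms(1)] by metis
  have "D = {..<m}"
    using m least assms(2) by (metis lessThan_iff linorder_neqE_nat subsetI subset_antisym)
  then show ?thesis by (metis card_lessThan)
qed

text \<open>
  The row lengths of the part of a tableau that carries the entries below \<open>n\<close>. It is meant for tableaux
  with entries at most \<open>n\<close>, whose remaining cells carry the entry \<open>n\<close>.
\<close>

definition small_shape :: "nat \<Rightarrow> nat list \<Rightarrow> (nat \<times> nat \<Rightarrow> nat) \<Rightarrow> nat \<Rightarrow> nat" where
  "small_shape n la T = (\<lambda>i\<in>{0..<length la}. card {j. j < la ! i \<and> T (i, j) < n})"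

text \<open>
  Rows increase weakly, so the entries below \<open>n\<close> form an initial segment of each row.
\<close>

lemma less_small_shape_iff:
  assumes T: "T \<in> ssyt la" and ij: "(i, j) \<in> cells la"
  shows "j < small_shape n la T i \<longleftrightarrow> T (i, j) < n"
proof -
  define D where "D = {j. j < la ! i \<and> T (i, j) < n}"
  have "k \<in> D" if "j \<in> D" "k < j" for j k
    using that
  proof (induction j)
    case (Suc j)
    then have "T (i, j) \<le> T (i, Suc j)"
      using T ij by (auto simp: ssyt_def D_def mem_cells)
    with Suc.prems have "j \<in> D" by (simp add: D_def)
    with Suc show ?case by (metis less_SucE)
  qed simp
  then have "D = {..<card D}" by (intro downclosed_nat_set) (auto simp: D_def)
  moreover have "small_shape n la T i = card D"
    using ij by (simp add: small_shape_def D_def mem_cells)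
  moreover have "j \<in> D \<longleftrightarrow> T (i, j) < n" using ij by (simp add: D_def mem_cells)
  ultimately show ?thesis by (metis lessThan_iff)
qed

text \<open>
  Columns increase strictly and \<open>n\<close> is the largest entry, so only the lowest cell of a column can
  carry it: every cell that has a cell below it carries an entry below \<open>n\<close>.
\<close>

lemma small_shape_in_strips:
  assumes la: "is_partition la" and T: "T \<in> ssyt la" and le: "\<And>c. c \<in> cells la \<Longrightarrow> T c \<le> n"
  shows "small_shape n la T \<in> strips la"
proof -
  have "small_shape n la T i \<le> la ! i" if "i < length la" for i
    using that card_mono[of "{..<la ! i}" "{j. j < la ! i \<and> T (i, j) < n}"]
    by (auto simp: small_shape_def)
  moreover have "next_part la i \<le> small_shape n la T i" if i: "i < length la" for i
  proof (cases "next_part la i")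
    case (Suc j)
    then have c: "(Suc i, j) \<in> cells la" by (simp add: next_part_def mem_cells split: if_splits)
    have "(i, j) \<in> cells la"
      using next_part_le[OF la i] Suc i by (simp add: mem_cells)
    moreover from this c T have "T (i, j) < T (Suc i, j)" by (simp add: ssyt_def)
    ultimately have "j < small_shape n la T i"
      using less_small_shape_iff[OF T] le[OF c] by simp
    with Suc show ?thesis by simp
  qed simp
  moreover have "small_shape n la T i = undefined" if "\<not> i < length la" for i
    using that by (simp add: small_shape_def)
  ultimately show ?thesis by (auto simp: strips_def PiE_iff extensional_def)
qed

definition fill_strip :: "nat \<Rightarrow> nat list \<Rightarrow> (nat \<Rightarrow> nat) \<Rightarrow> (nat \<times> nat \<Rightarrow> nat) \<Rightarrow> nat \<times> nat \<Rightarrow> nat"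
  where "fill_strip n la f T =
    (\<lambda>c\<in>cells la. if c \<in> cells (map f [0..<length la]) then T c else n)"

lemma fill_strip_in_ssyt:
  assumes f: "f \<in> strips la" and T: "T \<in> ssyt (map f [0..<length la])"
    and less: "\<And>c. c \<in> cells (map f [0..<length la]) \<Longrightarrow> T c < n"
  shows "fill_strip n la f T \<in> ssyt la"
proof -
  define mu where "mu = map f [0..<length la]"
  have sub: "cells mu \<subseteq> cells la" unfolding mu_def by (rule cells_strip_subset[OF f])
  have row: "fill_strip n la f T (i, j) \<le> fill_strip n la f T (i, Suc j)"
    if "(i, j) \<in> cells la" "(i, Suc j) \<in> cells la" for i j
  proof (cases "(i, Suc j) \<in> cells mu")
    case True
    then have "(i, j) \<in> cells mu" by (simp add: mu_def mem_cells_map)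
    with True that T show ?thesis by (simp add: fill_strip_def ssyt_def flip: mu_def)
  next
    case False
    with that less show ?thesis by (auto simp: fill_strip_def mu_def less_imp_le)
  qed
  have col: "fill_strip n la f T (i, j) < fill_strip n la f T (Suc i, j)"
    if "(i, j) \<in> cells la" "(Suc i, j) \<in> cells la" for i j
  proof -
    have "(i, j) \<in> cells mu"
      using that stripsD(1)[OF f, of i] by (auto simp: mem_cells mem_cells_map next_part_def mu_def)
    then show ?thesis
      using that T less by (auto simp: fill_strip_def ssyt_def mu_def)
  qed
  show ?thesis using row col by (auto simp: ssyt_def fill_strip_def)
qed

lemma small_shape_fill_strip:
  assumes f: "f \<in> strips la"
    and less: "\<And>c. c \<in> cells (map f [0..<length la]) \<Longrightarrow> T c < n"
  shows "small_shape n la (fill_strip n la f T) = f"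
proof
  fix i
  show "small_shape n la (fill_strip n la f T) i = f i"
  proof (cases "i < length la")
    case True
    have "{j. j < la ! i \<and> fill_strip n la f T (i, j) < n} = {..<f i}"
      using True stripsD(2)[OF f True] less
      by (auto simp: fill_strip_def mem_cells mem_cells_map split: if_splits)
    with True show ?thesis by (simp add: small_shape_def)
  next
    case False
    with f show ?thesis by (simp add: small_shape_def strips_def PiE_iff extensional_def)
  qed
qed

text \<open>
  Removing the cells with the largest entry \<open>n\<close> from a tableau leaves a tableau whose shape is \<open>\<lambda>\<close>
  minus a horizontal strip; filling the strip with \<open>n\<close> is the inverse operation.
\<close>

lemma card_ssyt_branching:
  assumes la: "is_partition la" and M: "set_mset M \<subseteq> {..<Suc n}"
  shows "card {T \<in> ssyt la. Defs.content la T = M} =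
    (\<Sum>f\<in>strips la. card {T \<in> ssyt (map f [0..<length la]).
        set_mset (Defs.content (map f [0..<length la]) T) \<subseteq> {..<n} \<and>
        Defs.content (map f [0..<length la]) T
          + replicate_mset (\<Sum>i=0..<length la. la ! i - f i) n = M})"
    (is "card ?A = (\<Sum>f\<in>_. card (?B f))")
proof -
  let ?mu = "\<lambda>f. map f [0..<length la]"
  let ?cut = "\<lambda>T. (small_shape n la T, restrict T (cells (?mu (small_shape n la T))))"
  let ?fill = "\<lambda>(f, T). fill_strip n la f T"
  have "bij_betw ?cut ?A (SIGMA f:strips la. ?B f)"
  proof (rule bij_betw_byWitness[where f' = ?fill])
    show "\<forall>T\<in>?A. ?fill (?cut T) = T"
    proof
      fix T assume "T \<in> ?A"
      then have T: "T \<in> ssyt la" and cT: "Defs.content la T = M" by auto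
      have le: "T c \<le> n" if "c \<in> cells la" for c
        using M cT that set_mset_content[of la T] by force
      show "?fill (?cut T) = T"
      proof
        fix c :: "nat \<times> nat"
        obtain i j where c: "c = (i, j)" by (cases c)
        show "?fill (?cut T) c = T c"
          using T less_small_shape_iff[OF T, of i j n] le[of "(i, j)"]
          by (auto simp: c fill_strip_def ssyt_def PiE_iff extensional_def mem_cells_map mem_cells)
      qed
    qed
    show "\<forall>z\<in>(SIGMA f:strips la. ?B f). ?cut (?fill z) = z"
    proof
      fix z assume "z \<in> (SIGMA f:strips la. ?B f)"
      then obtain f T where z: "z = (f, T)" and f: "f \<in> strips la" and T: "T \<in> ?B f" by auto
      from T have less: "\<And>c. c \<in> cells (?mu f) \<Longrightarrow> T c < n"
        by (auto simp: set_mset_content)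
      have "restrict (fill_strip n la f T) (cells (?mu f)) = T"
        using T cells_strip_subset[OF f]
        by (auto simp: fun_eq_iff fill_strip_def ssyt_def PiE_iff extensional_def restrict_def)
      then show "?cut (?fill z) = z"
        by (simp add: z small_shape_fill_strip[OF f less])
    qed
    show "?cut ` ?A \<subseteq> (SIGMA f:strips la. ?B f)"
    proof
      fix z assume "z \<in> ?cut ` ?A"
      then obtain T where z: "z = ?cut T" and T: "T \<in> ssyt la" and cT: "Defs.content la T = M"
        by auto
      have le: "T c \<le> n" if "c \<in> cells la" for c
        using M cT that set_mset_content[of la T] by force
      define f where "f = small_shape n la T"
      have f: "f \<in> strips la" unfolding f_def by (rule small_shape_in_strips[OF la T le])
      have sub: "cells (?mu f) \<subseteq> cells la" by (rule cells_strip_subset[OF f])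
      have in_iff: "c \<in> cells (?mu f) \<longleftrightarrow> T c < n" if "c \<in> cells la" for c
        using less_small_shape_iff[OF T, of "fst c" "snd c" n] that
        by (cases c) (auto simp: f_def mem_cells_map mem_cells)
      have "restrict T (cells (?mu f)) \<in> ssyt (?mu f)"
        using T by (auto simp: ssyt_def subsetD[OF sub])
      moreover have "T c = n" if "c \<in> cells la - cells (?mu f)" for c
        using that in_iff[of c] le[of c] by auto
      then have "Defs.content (?mu f) (restrict T (cells (?mu f)))
          + replicate_mset (\<Sum>i=0..<length la. la ! i - f i) n = M"
        unfolding cT[symmetric] by (intro content_extend_strip[OF f, symmetric]) auto
      moreover have "set_mset (Defs.content (?mu f) (restrict T (cells (?mu f)))) \<subseteq> {..<n}"
        using in_iff sub by (auto simp: set_mset_content)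
      ultimately show "z \<in> (SIGMA f:strips la. ?B f)"
        using f by (simp add: z f_def)
    qed
    show "?fill ` (SIGMA f:strips la. ?B f) \<subseteq> ?A"
    proof
      fix T' assume "T' \<in> ?fill ` (SIGMA f:strips la. ?B f)"
      then obtain f T where T': "T' = fill_strip n la f T" and f: "f \<in> strips la" and T: "T \<in> ?B f"
        by auto
      from T have less: "\<And>c. c \<in> cells (?mu f) \<Longrightarrow> T c < n"
        by (auto simp: set_mset_content)
      have "T' \<in> ssyt la" unfolding T' using T less by (intro fill_strip_in_ssyt[OF f]) auto
      moreover have "Defs.content la T' = M"
        using T cells_strip_subset[OF f]
        by (subst content_extend_strip[OF f, of _ T n]) (auto simp: T' fill_strip_def)
      ultimately show "T' \<in> ?A" by simp
    qed
  qed
  then have "card ?A = card (SIGMA f:strips la. ?B f)" by (rule bij_betw_same_card)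
  also have "\<dots> = (\<Sum>f\<in>strips la. card (?B f))"
  proof (rule card_SigmaI)
    show "finite (strips la)" unfolding strips_def by (rule finite_PiE) auto
    show "\<forall>f\<in>strips la. finite (?B f)"
    proof
      fix f
      let ?R = "replicate_mset (\<Sum>i=0..<length la. la ! i - f i) n"
      have "?B f \<subseteq> {T \<in> ssyt (?mu f). Defs.content (?mu f) T = M - ?R}" by auto
      then show "finite (?B f)" by (rule finite_subset) (rule finite_ssyt_content)
    qed
  qed
  finally show ?thesis .
qed

lemma mcoeff_schur:
  "is_partition la \<Longrightarrow> mcoeff (schur la) M = of_nat (card {T \<in> ssyt la. Defs.content la T = M})"
  by (simp add: schur_def)

lemma schur_branching:
  assumes la: "is_partition la"
  shows "first_vars (Suc n) (schur la) =
    (\<Sum>f\<in>strips la. monomial (replicate_mset (\<Sum>i=0..<length la. la ! i - f i) n) *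
      first_vars n (schur (map f [0..<length la])))"
proof (rule mfps_eqI)
  fix M
  let ?mu = "\<lambda>f. map f [0..<length la]"
  let ?R = "\<lambda>f. replicate_mset (\<Sum>i=0..<length la. la ! i - f i) n"
  have mcoeff_sum: "mcoeff (sum F A) M = (\<Sum>f\<in>A. mcoeff (F f) M)" for F and A :: "(nat \<Rightarrow> nat) set"
    by (induction A rule: infinite_finite_induct) (auto simp: zero_mfps.rep_eq plus_mfps.rep_eq)
  have summand: "mcoeff (monomial (?R f) * first_vars n (schur (?mu f))) M =
      of_nat (card {T \<in> ssyt (?mu f). set_mset (Defs.content (?mu f) T) \<subseteq> {..<n} \<and>
        Defs.content (?mu f) T + ?R f = M})" if f: "f \<in> strips la" for f
  proof (cases "?R f \<subseteq># M \<and> set_mset (M - ?R f) \<subseteq> {..<n}")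
    case True
    then have "{T \<in> ssyt (?mu f). set_mset (Defs.content (?mu f) T) \<subseteq> {..<n} \<and>
        Defs.content (?mu f) T + ?R f = M} = {T \<in> ssyt (?mu f). Defs.content (?mu f) T = M - ?R f}"
      by auto
    with True show ?thesis
      by (simp add: mcoeff_monomial_mult mcoeff_first_vars mcoeff_schur is_partition_strip[OF la f])
  next
    case False
    then have "{T \<in> ssyt (?mu f). set_mset (Defs.content (?mu f) T) \<subseteq> {..<n} \<and>
        Defs.content (?mu f) T + ?R f = M} = {}"
      by auto
    moreover have "mcoeff (monomial (?R f) * first_vars n (schur (?mu f))) M = 0"
      using False unfolding mcoeff_monomial_mult mcoeff_first_vars by (simp split: if_split)
    ultimately show ?thesis by (simp only: card.empty of_nat_0)
  qed
  show "mcoeff (first_vars (Suc n) (schur la)) M =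
      mcoeff (\<Sum>f\<in>strips la. monomial (?R f) * first_vars n (schur (?mu f))) M"
  proof (cases "set_mset M \<subseteq> {..<Suc n}")
    case True
    then show ?thesis
      by (simp add: mcoeff_first_vars mcoeff_schur[OF la] card_ssyt_branching[OF la True] mcoeff_sum
          summand)
  next
    case False
    have "{T \<in> ssyt (?mu f). set_mset (Defs.content (?mu f) T) \<subseteq> {..<n} \<and>
        Defs.content (?mu f) T + ?R f = M} = {}" for f
      using False by (auto simp: less_Suc_eq split: if_splits)
    then have "mcoeff (\<Sum>f\<in>strips la. monomial (?R f) * first_vars n (schur (?mu f))) M = 0"
      unfolding mcoeff_sum by (intro sum.neutral ballI) (simp only: summand card.empty of_nat_0)
    with False show ?thesis
      by (simp add: mcoeff_first_vars)
  qed
qed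

section \<open>The Jacobi--Trudi formula\<close>

text \<open>
  Without variables both sides are \<open>1\<close> for the empty diagram and \<open>0\<close> otherwise. The determinant
  is unitriangular in the first case and has a zero first row in the second.
\<close>

lemma first_vars_0_schur:
  assumes la: "is_partition la"
  shows "first_vars 0 (schur la) = jacobi_trudi (\<lambda>m. first_vars 0 (complete_sym m)) la"
proof (cases "\<forall>i<length la. la ! i = 0")
  case True
  then have e: "cells la = {}" by (auto simp: cells_def)
  then have "{T \<in> ssyt la. Defs.content la T = {#}} = {\<lambda>_. undefined}"
    by (auto simp: ssyt_def Defs.content_def)
  then have "first_vars 0 (schur la) = 1"
    by (intro mfps_eqI) (auto simp: mcoeff_first_vars mcoeff_schur la one_mfps.rep_eq)
  moreover have "jacobi_trudi (\<lambda>m. first_vars 0 (complete_sym m)) la = 1"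
    unfolding jacobi_trudi_def using True
    by (subst det_upper_triangular[of _ "length la"])
      (auto simp: upper_triangular_def first_vars_0_complete_sym prod_list_diag_prod)
  ultimately show ?thesis by simp
next
  case False
  then obtain i where i: "i < length la" "la ! i > 0" by auto
  then have "la ! 0 \<ge> la ! i"
    using la by (cases "i = 0") (auto simp: is_partition_def sorted_wrt_iff_nth_less)
  with i have l: "0 < length la" "0 < la ! 0" by auto
  then have "(0, 0) \<in> cells la" by (simp add: mem_cells)
  then have "Defs.content la T \<noteq> {#}" for T
    using set_mset_content[of la T] by auto
  then have "first_vars 0 (schur la) = 0"
    by (intro mfps_eqI) (auto simp: mcoeff_first_vars mcoeff_schur la zero_mfps.rep_eq)
  moreover have "jacobi_trudi (\<lambda>m. first_vars 0 (complete_sym m)) la = 0"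
    unfolding jacobi_trudi_def
    by (subst laplace_expansion_row[of _ "length la" 0])
      (use l in \<open>auto simp: first_vars_0_complete_sym intro!: sum.neutral\<close>)
  ultimately show ?thesis by simp
qed

text \<open>
  In each number of variables both sides satisfy the same recursion over horizontal strips.
\<close>

theorem schur_eq_jacobi_trudi:
  assumes "is_partition la"
  shows "schur la = jacobi_trudi complete_sym la"
proof (rule eq_if_first_vars_eq)
  fix n
  have "first_vars n (schur la) = jacobi_trudi (\<lambda>m. first_vars n (complete_sym m)) la"
    using assms
  proof (induction n arbitrary: la)
    case 0
    then show ?case by (rule first_vars_0_schur)
  next
    case (Suc n)
    then show ?case
      by (auto simp: schur_branching jacobi_trudi_branching is_partition_strip intro!: sum.cong)
  qed
  also have "\<dots> = first_vars n (jacobi_trudi complete_sym la)"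
    unfolding jacobi_trudi_def first_vars.hom_det[symmetric, of n "mat _ _ _"]
    by (rule arg_cong[where f = det]) (auto intro!: eq_matI)
  finally show "first_vars n (schur la) = first_vars n (jacobi_trudi complete_sym la)" .
qed

section \<open>Laplace expansion along pairs of rows\<close>

definition minor2 :: "('b \<Rightarrow> 'a :: comm_ring_1) \<Rightarrow> ('b \<Rightarrow> 'a) \<Rightarrow> 'b \<Rightarrow> 'b \<Rightarrow> 'a" where
  "minor2 r s i j = r i * s j - r j * s i"

text \<open>
  Half of the Laplace expansion of a determinant of order four along its two upper and its two lower
  rows; the arguments \<open>i, j, k, l\<close> name the columns. The six terms of the expansion form three pairs
  that are exchanged by interchanging the upper and the lower rows, and one term of each pair is taken.
\<close>

definition half_laplace ::
  "('b \<Rightarrow> 'a :: comm_ring_1) \<Rightarrow> ('b \<Rightarrow> 'a) \<Rightarrow> ('b \<Rightarrow> 'a) \<Rightarrow> ('b \<Rightarrow> 'a)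
     \<Rightarrow> 'b \<Rightarrow> 'b \<Rightarrow> 'b \<Rightarrow> 'b \<Rightarrow> 'a" where
  "half_laplace r s u v i j k l = minor2 r s i j * minor2 u v k l
     - minor2 r s i k * minor2 u v j l + minor2 r s j k * minor2 u v i l"

definition laplace ::
  "('b \<Rightarrow> 'a :: comm_ring_1) \<Rightarrow> ('b \<Rightarrow> 'a) \<Rightarrow> ('b \<Rightarrow> 'a) \<Rightarrow> ('b \<Rightarrow> 'a)
     \<Rightarrow> 'b \<Rightarrow> 'b \<Rightarrow> 'b \<Rightarrow> 'b \<Rightarrow> 'a" where
  "laplace r s u v i j k l = half_laplace r s u v i j k l + half_laplace u v r s i j k l"

lemma det_last_row:
  fixes f :: "nat \<Rightarrow> nat \<Rightarrow> 'a :: comm_ring_1"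
  shows "det (mat (Suc n) (Suc n) (\<lambda>(i, j). f i j)) = (\<Sum>j<Suc n. (-1) ^ (n + j) * f n j *
    det (mat n n (\<lambda>(i, k). f i (if k < j then k else Suc k))))"
proof -
  define A where "A = mat (Suc n) (Suc n) (\<lambda>(i, j). f i j)"
  have "mat_delete A n j = mat n n (\<lambda>(i, k). f i (if k < j then k else Suc k))" for j
    by (rule eq_matI) (auto simp: A_def mat_delete_def)
  then have "A $$ (n, j) * cofactor A n j = (-1) ^ (n + j) * f n j *
      det (mat n n (\<lambda>(i, k). f i (if k < j then k else Suc k)))" if "j < Suc n" for j
    using that by (simp add: A_def cofactor_def)
  then show ?thesis
    using laplace_expansion_row[of A "Suc n" n] by (simp add: A_def del: sum.lessThan_Suc)
qed

lemma det_2: "det (mat 2 2 (\<lambda>(i, j). f i j)) = minor2 (f 0) (f 1) 0 1"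
  by (simp add: numeral_2_eq_2 det_last_row minor2_def algebra_simps)

lemma det_3: "det (mat 3 3 (\<lambda>(i, j). f i j)) =
   f 2 0 * minor2 (f 0) (f 1) 1 2 - f 2 1 * minor2 (f 0) (f 1) 0 2 + f 2 2 * minor2 (f 0) (f 1) 0 1"
proof -
  have 3: "(3 :: nat) = Suc 2" by simp
  show ?thesis
    unfolding 3 det_last_row det_2
    by (simp add: numeral_2_eq_2 minor2_def)
qed

lemma det_4: "det (mat 4 4 (\<lambda>(i, j). f i j)) = laplace (f 0) (f 1) (f 2) (f 3) 0 1 2 3"
proof -
  have 4: "(4 :: nat) = Suc 3" by simp
  have Suc: "{..<Suc 3} = {0, 1, 2, 3 :: nat}" by auto
  show ?thesis
    unfolding 4 det_last_row det_3 Suc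
    by (simp add: numeral_3_eq_3 numeral_2_eq_2 minor2_def laplace_def half_laplace_def
        algebra_simps)
qed

lemma det_5: "det (mat 5 5 (\<lambda>(i, j). f i j)) =
     f 4 0 * laplace (f 0) (f 1) (f 2) (f 3) 1 2 3 4
   - f 4 1 * laplace (f 0) (f 1) (f 2) (f 3) 0 2 3 4
   + f 4 2 * laplace (f 0) (f 1) (f 2) (f 3) 0 1 3 4
   - f 4 3 * laplace (f 0) (f 1) (f 2) (f 3) 0 1 2 4
   + f 4 4 * laplace (f 0) (f 1) (f 2) (f 3) 0 1 2 3"
proof -
  have 5: "(5 :: nat) = Suc 4" by simp
  have Suc: "{..<Suc 4} = {0, 1, 2, 3, 4 :: nat}" by auto
  show ?thesis
    unfolding 5 det_last_row det_4 Suc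
    by (simp add: eval_nat_numeral laplace_def half_laplace_def minor2_def)
qed

text \<open>
  The Pluecker relation. The full expansion vanishes because rows are repeated, but cancelling the
  factor \<open>2\<close> is not possible in every ring, so the relation is checked for the half itself.
\<close>

lemma half_laplace_same: "half_laplace r s r s i j k l = 0"
  by (simp add: half_laplace_def minor2_def algebra_simps)

lemma half_laplace_shared: "half_laplace r s s u i j k l + half_laplace s u r s i j k l = 0"
  by (simp add: half_laplace_def minor2_def algebra_simps)

section \<open>Folding a square into a triangle\<close>

text \<open>
  A symmetric function on pairs of integers that vanishes for \<open>\<bar>i - j\<bar> \<le> 1\<close> can be summed over
  \<open>i \<ge> j + 2\<close> by summing one half of it over all pairs. This replaces the constrained sums over
  \<open>b \<le> a\<close> by convolutions, hence by products of series in one index.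
\<close>

lemma pair_series_fold:
  fixes Q :: "nat \<Rightarrow> nat \<Rightarrow> mfps"
  assumes diag: "\<And>i. Q i i = 0" and off: "\<And>i. Q i (Suc i) + Q (Suc i) i = 0"
  shows "pair_series 2 (\<lambda>a b. Q (a + 2) b + Q b (a + 2)) = Abs_fps (\<lambda>n. \<Sum>i=0..n. Q i (n - i))"
proof (rule fps_ext)
  fix n :: nat
  define A where "A = {i. i \<le> n \<and> n - i + 2 \<le> i}"
  define B where "B = {i. i \<le> n \<and> i + 2 \<le> n - i}"
  define C where "C = {i. i \<le> n \<and> i \<le> Suc (n - i) \<and> n - i \<le> Suc i}"
  have fin: "finite A" "finite B" "finite C" by (auto simp: A_def B_def C_def)
  have "{0..n} = A \<union> (B \<union> C)" by (auto simp: A_def B_def C_def)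
  moreover have "A \<inter> (B \<union> C) = {}" "B \<inter> C = {}" by (auto simp: A_def B_def C_def)
  ultimately have "(\<Sum>i=0..n. Q i (n - i)) =
      (\<Sum>i\<in>A. Q i (n - i)) + ((\<Sum>i\<in>B. Q i (n - i)) + (\<Sum>i\<in>C. Q i (n - i)))"
    using fin by (simp add: sum.union_disjoint)
  also have "(\<Sum>i\<in>C. Q i (n - i)) = 0"
  proof (cases "even n")
    case True
    then obtain m where "n = 2 * m" by blast
    then have "C = {m}" by (auto simp: C_def)
    with diag \<open>n = 2 * m\<close> show ?thesis by simp
  next
    case False
    then obtain m where "n = Suc (2 * m)" using oddE by fastforce
    then have "C = {m, Suc m}" by (auto simp: C_def)
    with off[of m] \<open>n = Suc (2 * m)\<close> show ?thesis by (simp add: Suc_diff_le)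
  qed
  also have "(\<Sum>i\<in>A. Q i (n - i)) = (\<Sum>(a, b) | b \<le> a \<and> a + b + 2 = n. Q (a + 2) b)"
    by (rule sum.reindex_bij_witness[where i = "\<lambda>(a, b). a + 2" and j = "\<lambda>i. (i - 2, n - i)"])
      (auto simp: A_def numeral_2_eq_2 Suc_diff_Suc)
  also have "(\<Sum>i\<in>B. Q i (n - i)) = (\<Sum>(a, b) | b \<le> a \<and> a + b + 2 = n. Q b (a + 2))"
    by (rule sum.reindex_bij_witness[where i = "\<lambda>(a, b). b" and j = "\<lambda>i. (n - i - 2, i)"])
      (auto simp: B_def numeral_2_eq_2 Suc_diff_Suc)
  finally show "fps_nth (pair_series 2 (\<lambda>a b. Q (a + 2) b + Q b (a + 2))) n =
      fps_nth (Abs_fps (\<lambda>n. \<Sum>i=0..n. Q i (n - i))) n"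
    by (simp add: pair_series_def sum.distrib case_prod_unfold)
qed

lemma pair_series_peel:
  "pair_series d c = fps_X ^ d * Abs_fps (\<lambda>a. c a 0)
     + pair_series (d + 2) (\<lambda>a b. c (a + 1) (b + 1))"
proof (rule fps_ext)
  fix n
  define A where "A = {(a, b). b \<le> a \<and> a + b + d = n \<and> b = 0}"
  define B where "B = {(a, b). b \<le> a \<and> a + b + d = n \<and> b > 0}"
  have "{(a, b). b \<le> a \<and> a + b + d = n} = A \<union> B" "A \<inter> B = {}" by (auto simp: A_def B_def)
  moreover from this have "finite A" "finite B"
    using finite_pair_series_index[of d n] by auto
  ultimately have "(\<Sum>(a, b) | b \<le> a \<and> a + b + d = n. c a b) =
      (\<Sum>(a, b)\<in>A. c a b) + (\<Sum>(a, b)\<in>B. c a b)"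
    by (simp add: sum.union_disjoint)
  also have "A = (if d \<le> n then {(n - d, 0)} else {})" by (auto simp: A_def)
  also have "(\<Sum>(a, b)\<in>B. c a b) =
      (\<Sum>(a, b) | b \<le> a \<and> a + b + (d + 2) = n. c (a + 1) (b + 1))"
    by (rule sum.reindex_bij_witness
        [where i = "\<lambda>(a, b). (a + 1, b + 1)" and j = "\<lambda>(a, b). (a - 1, b - 1)"])
      (auto simp: B_def)
  finally show "fps_nth (pair_series d c) n = fps_nth (fps_X ^ d * Abs_fps (\<lambda>a. c a 0)
     + pair_series (d + 2) (\<lambda>a b. c (a + 1) (b + 1))) n"
    by (simp add: pair_series_def fps_X_power_mult_nth)
qed

lemma pair_series_shift: "pair_series (k + d) c = fps_X ^ k * pair_series d c"
proof (rule fps_ext)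
  fix n
  have "{(a, b). b \<le> a \<and> a + b + (k + d) = n} =
      (if k \<le> n then {(a, b). b \<le> a \<and> a + b + d = n - k} else {})"
    by auto
  then show "fps_nth (pair_series (k + d) c) n = fps_nth (fps_X ^ k * pair_series d c) n"
    by (simp add: pair_series_def fps_X_power_mult_nth)
qed

section \<open>Schur functions of few rows\<close>

text \<open>
  The part of a row of a Jacobi--Trudi matrix whose entry in column \<open>0\<close> is \<open>h\<^sub>a\<close>.
\<close>

definition hrow :: "int \<Rightarrow> nat \<Rightarrow> mfps" where
  "hrow a j = complete_sym (a + int j)"

text \<open>
  The minors of the two rows that come from two equal parts \<open>(a, a)\<close>.
\<close>

definition pair_minor :: "int \<Rightarrow> nat \<Rightarrow> nat \<Rightarrow> mfps" where
  "pair_minor a = minor2 (hrow a) (hrow (a - 1))"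

lemma schur_eq_det:
  assumes "is_partition la" "length la = l"
  shows "schur la = det (mat l l (\<lambda>(i, j). hrow (int (la ! i) - int i) j))"
  using schur_eq_jacobi_trudi[OF assms(1)] assms(2) by (simp add: jacobi_trudi_def hrow_def)

lemma schur_2: "q \<le> p \<Longrightarrow> schur [p, q] = minor2 (hrow (int p)) (hrow (int q - 1)) 0 1"
  by (subst schur_eq_det[where l = 2]) (simp_all add: is_partition_def det_2)

text \<open>
  A minor of a pair of rows depends, up to a shift of the index, only on the distance of its columns:
  each is a Schur function of two rows whose lengths differ by that distance minus \<open>1\<close>.
\<close>

lemma schur_2_pair_minor:
  assumes "i < j"
  shows "schur [k + (j - i - 1), k] = pair_minor (int k - int i) i j"
  using assms
  by (simp add: schur_2 pair_minor_def minor2_def hrow_def of_nat_diff algebra_simps)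

lemma schur_4:
  "b \<le> a \<Longrightarrow> schur [a, a, b, b] =
     laplace (hrow (int a)) (hrow (int a - 1)) (hrow (int b - 2)) (hrow (int b - 3)) 0 1 2 3"
  by (subst schur_eq_det[where l = 4]) (simp_all add: is_partition_def det_4)

lemma schur_5:
  assumes "e \<le> b" "b \<le> a"
  defines "L \<equiv> laplace (hrow (int a)) (hrow (int a - 1)) (hrow (int b - 2)) (hrow (int b - 3))"
  shows "schur [a, a, b, b, e] =
     hrow (int e - 4) 0 * L 1 2 3 4 - hrow (int e - 4) 1 * L 0 2 3 4
   + hrow (int e - 4) 2 * L 0 1 3 4 - hrow (int e - 4) 3 * L 0 1 2 4
   + hrow (int e - 4) 4 * L 0 1 2 3"
  using assms
  by (subst schur_eq_det[where l = 5]) (simp_all add: is_partition_def det_5)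

lemmas complete_sym_simps = complete_sym_0 complete_sym_neg

text \<open>
  The following shapes have two equal long rows. The determinant is expanded along these, and the
  complementary minors of the short rows are polynomials in \<open>h\<^sub>1, h\<^sub>2, h\<^sub>3\<close>. For small \<open>k\<close> the shape
  is not a partition; there the expansion vanishes as well, since the matrix has a repeated row.
\<close>

lemma schur_kk1:
  "schur [k, k, 1] = complete_sym 1 * pair_minor (int k) 0 1 - pair_minor (int k) 0 2"
proof (cases "k = 0")
  case True
  then show ?thesis
    by (simp add: schur_def is_partition_def pair_minor_def minor2_def hrow_def complete_sym_simps)
next
  case False
  then show ?thesis
    by (subst schur_eq_det[where l = 3])
      (simp_all add: is_partition_def det_3 pair_minor_def hrow_def complete_sym_simps)
qed

lemma schur_kk11:
  "schur [k, k, 1, 1] = ((complete_sym 1)\<^sup>2 - complete_sym 2) * pair_minor (int k) 0 1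
     - complete_sym 1 * pair_minor (int k) 0 2 + pair_minor (int k) 0 3"
proof (cases "k = 0")
  case True
  then show ?thesis
    by (simp add: schur_def is_partition_def pair_minor_def minor2_def hrow_def complete_sym_simps
        power2_eq_square algebra_simps)
next
  case False
  then show ?thesis
    by (subst schur_eq_det[where l = 4])
      (simp_all add: is_partition_def det_4 pair_minor_def laplace_def half_laplace_def minor2_def
        hrow_def complete_sym_simps power2_eq_square algebra_simps)
qed

lemma schur_kk111:
  "schur [k, k, 1, 1, 1] =
     ((complete_sym 1) ^ 3 - 2 * complete_sym 1 * complete_sym 2 + complete_sym 3)
       * pair_minor (int k) 0 1
     - ((complete_sym 1)\<^sup>2 - complete_sym 2) * pair_minor (int k) 0 2
     + complete_sym 1 * pair_minor (int k) 0 3 - pair_minor (int k) 0 4"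
proof (cases "k = 0")
  case True
  then show ?thesis
    by (simp add: schur_def is_partition_def pair_minor_def minor2_def hrow_def complete_sym_simps
        power2_eq_square power3_eq_cube algebra_simps)
next
  case False
  then show ?thesis
    by (subst schur_eq_det[where l = 5])
      (simp_all add: is_partition_def det_5 pair_minor_def laplace_def half_laplace_def minor2_def
        hrow_def complete_sym_simps power2_eq_square power3_eq_cube algebra_simps)
qed

text \<open>
  The Jacobi--Trudi determinant of the index sequence \<open>(a, a, 2, 2)\<close>, expanded as above, for an
  arbitrary integer \<open>a\<close>.
\<close>

definition kk22_expansion :: "int \<Rightarrow> mfps" where
  "kk22_expansion a = ((complete_sym 2)\<^sup>2 - complete_sym 1 * complete_sym 3) * pair_minor a 0 1
     - (complete_sym 1 * complete_sym 2 - complete_sym 3) * pair_minor a 0 2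
     + ((complete_sym 1)\<^sup>2 - complete_sym 2) * pair_minor a 0 3
     + complete_sym 2 * pair_minor a 1 2 - complete_sym 1 * pair_minor a 1 3 + pair_minor a 2 3"

lemma schur_kk22: "schur [k, k, 2, 2] = kk22_expansion (int k)"
proof (cases "k < 2")
  case True
  then have "k = 0 \<or> k = 1" by auto
  then show ?thesis
    by (auto simp: kk22_expansion_def schur_def is_partition_def pair_minor_def minor2_def hrow_def
        complete_sym_simps power2_eq_square algebra_simps)
next
  case False
  then show ?thesis
    by (subst schur_eq_det[where l = 4])
      (simp_all add: kk22_expansion_def is_partition_def det_4 pair_minor_def laplace_def half_laplace_def
        minor2_def hrow_def complete_sym_simps power2_eq_square algebra_simps)
qed

text \<open>
  For \<open>a = -2\<close> the determinant is that of a permutation of the rows of a unitriangular matrix, and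
  it contributes an extra term \<open>1 / t\<^sup>2\<close> to the series over all integers.
\<close>

lemma kk22_expansion_below: "kk22_expansion (- 2) = 1" "kk22_expansion (- 1) = 0"
  by (simp_all add: kk22_expansion_def pair_minor_def minor2_def hrow_def complete_sym_simps
      power2_eq_square algebra_simps)

section \<open>Generating series in the row length\<close>

text \<open>
  The series of the minors with columns \<open>i, j\<close>, whose index starts at \<open>- s\<close>. The shift avoids
  Laurent series: a minor can be nonzero down to the index \<open>- i\<close>.
\<close>

definition minor_series :: "nat \<Rightarrow> nat \<Rightarrow> nat \<Rightarrow> mfps fps" where
  "minor_series s i j = Abs_fps (\<lambda>n. pair_minor (int n - int s) i j)"

lemma minor_series_eq:
  assumes "i < j" "i \<le> s"
  shows "minor_series s i j = fps_X ^ (s - i) * schur_series (\<lambda>k. [k + (j - i - 1), k])"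
proof (rule fps_ext)
  fix n
  show "fps_nth (minor_series s i j) n =
      fps_nth (fps_X ^ (s - i) * schur_series (\<lambda>k. [k + (j - i - 1), k])) n"
  proof (cases "n < s - i")
    case True
    then show ?thesis
      by (simp add: minor_series_def fps_X_power_mult_nth pair_minor_def minor2_def hrow_def
          complete_sym_neg)
  next
    case False
    then have "int (n - (s - i)) - int i = int n - int s" using assms by linarith
    with False show ?thesis
      by (simp only: minor_series_def fps_X_power_mult_nth schur_series_def
          schur_2_pair_minor[OF assms(1)] fps_nth_Abs_fps if_False)
  qed
qed

text \<open>
  Written as a function of \<open>\<alpha>\<close> and \<open>\<beta> - 2\<close>, the expansion for the parts \<open>(\<alpha>, \<alpha>, \<beta>, \<beta>)\<close> is
  symmetric, because interchanging two pairs of rows is an even permutation, and it vanishes if the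
  two arguments differ by at most \<open>1\<close>, because then the pairs share a row. So it can be folded.
  The pairs of rows are indexed from \<open>- 3\<close> on, which loses no nonzero minor whose smaller column is
  at most \<open>3\<close>. In this indexing \<open>\<alpha> = a - 1\<close> and \<open>\<beta> = b - 1\<close>.
\<close>

lemma pair_series_laplace:
  "pair_series 2 (\<lambda>a b. laplace (hrow (int a - 1)) (hrow (int a - 2))
      (hrow (int b - 3)) (hrow (int b - 4)) i j k l)
   = minor_series 3 i j * minor_series 3 k l - minor_series 3 i k * minor_series 3 j l
     + minor_series 3 j k * minor_series 3 i l"
proof -
  define Q where "Q = (\<lambda>a b. half_laplace (hrow (int a - 3)) (hrow (int a - 4))
      (hrow (int b - 3)) (hrow (int b - 4)) i j k l)"
  have "pair_series 2 (\<lambda>a b. laplace (hrow (int a - 1)) (hrow (int a - 2))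
      (hrow (int b - 3)) (hrow (int b - 4)) i j k l)
      = pair_series 2 (\<lambda>a b. Q (a + 2) b + Q b (a + 2))"
    by (simp add: Q_def laplace_def)
  also have "\<dots> = Abs_fps (\<lambda>n. \<Sum>a=0..n. Q a (n - a))"
  proof (rule pair_series_fold)
    fix a
    show "Q a a = 0" by (simp add: Q_def half_laplace_same)
    have "int (Suc a) - 3 = int a - 2" "int (Suc a) - 4 = int a - 3" by auto
    then show "Q a (Suc a) + Q (Suc a) a = 0"
      by (simp only: Q_def add.commute half_laplace_shared)
  qed
  also have "\<dots> = minor_series 3 i j * minor_series 3 k l
      - minor_series 3 i k * minor_series 3 j l + minor_series 3 j k * minor_series 3 i l"
    by (rule fps_ext)
      (simp add: Q_def half_laplace_def minor_series_def pair_minor_def fps_mult_nth sum.distrib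
        sum_subtractf)
  finally show ?thesis .
qed

lemma pair_series_add: "pair_series d (\<lambda>a b. f a b + g a b) = pair_series d f + pair_series d g"
  by (rule fps_ext) (simp add: pair_series_def sum.distrib case_prod_unfold)

lemma pair_series_diff: "pair_series d (\<lambda>a b. f a b - g a b) = pair_series d f - pair_series d g"
  by (rule fps_ext) (simp add: pair_series_def sum_subtractf case_prod_unfold)

lemma pair_series_const_mult: "pair_series d (\<lambda>a b. c * f a b) = fps_const c * pair_series d f"
  by (rule fps_ext) (simp add: pair_series_def sum_distrib_left case_prod_unfold)

lemma pair_series_cong:
  "(\<And>a b. b \<le> a \<Longrightarrow> f a b = g a b) \<Longrightarrow> pair_series d f = pair_series d g"
  unfolding pair_series_def by (intro arg_cong[where f = Abs_fps] ext sum.cong) auto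

lemma fps_X_power_mult_cancel:
  fixes f g :: "'a :: comm_ring_1 fps"
  assumes "fps_X ^ k * f = fps_X ^ k * g"
  shows "f = g"
proof (rule fps_ext)
  fix n
  show "fps_nth f n = fps_nth g n"
    using arg_cong[OF assms, of "\<lambda>h. fps_nth h (n + k)"] by (simp add: fps_X_power_mult_nth)
qed

lemma elem_sym_1_eq: "elem_sym 1 = complete_sym 1"
  unfolding elem_sym_1
  by (subst schur_eq_det[where l = 1]) (simp_all add: is_partition_def det_single hrow_def)

section \<open>The two identities\<close>

text \<open>
  The last row of the matrix for \<open>(\<alpha>, \<alpha>, \<beta>, \<beta>, 1)\<close> is \<open>(0, 0, 0, 1, h\<^sub>1)\<close>. Hence the minor in the
  columns \<open>0, 1, 2, 4\<close> of the other four rows is \<open>h\<^sub>1 s\<^bsub>(\<alpha>,\<alpha>,\<beta>,\<beta>)\<^esub> - s\<^bsub>(\<alpha>,\<alpha>,\<beta>,\<beta>,1)\<^esub>\<close>, and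
  the folded sum of these minors is minus the combination of products on the left-hand side.
\<close>

lemma two_row_products_eq_five_row:
  "fps_X * (schur_series (\<lambda>k. [k + 1, k]) * schur_series (\<lambda>k. [k + 2, k])
      - schur_series (\<lambda>k. [k, k]) * schur_series (\<lambda>k. [k + 3, k]))
    - schur_series (\<lambda>k. [k, k]) * schur_series (\<lambda>k. [k + 1, k])
  = pair_series 2 (\<lambda>a b. schur [a + 1, a + 1, b + 1, b + 1, 1])
    - fps_const (elem_sym 1) * pair_series 0 (\<lambda>a b. schur [a, a, b, b])"
proof -
  define P where "P d = schur_series (\<lambda>k. [k + d, k])" for d
  have P0: "P 0 = schur_series (\<lambda>k. [k, k])" by (simp add: P_def)
  define e where "e = fps_const (elem_sym 1)"
  define c where "c a b = laplace (hrow (int a - 1)) (hrow (int a - 2))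
      (hrow (int b - 3)) (hrow (int b - 4)) 0 1 2 4" for a b
  define F4 where "F4 = pair_series 2 (\<lambda>a b. schur [a + 1, a + 1, b + 1, b + 1])"
  define F5 where "F5 = pair_series 2 (\<lambda>a b. schur [a + 1, a + 1, b + 1, b + 1, 1])"
  have M: "minor_series 3 i j = fps_X ^ (3 - i) * P (j - i - 1)" if "i < j" "i \<le> 3" for i j
    using minor_series_eq[OF that] by (simp add: P_def)
  have "pair_series 2 c = fps_X ^ 4 * (P 0 * P 1 - fps_X * (P 1 * P 2 - P 0 * P 3))"
    unfolding c_def pair_series_laplace
    by (simp add: M) (simp add: algebra_simps eval_nat_numeral)
  moreover have "pair_series 2 c = fps_X ^ 4 * (e * P 0 + (e * F4 - F5))"
  proof -
    \<comment> \<open>The terms with \<open>b = 0\<close> and \<open>b = 1\<close> stand for \<open>\<beta> = -1\<close> and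
      \<open>\<beta> = 0\<close>, where \<open>(\<alpha>, \<alpha>, \<beta>, \<beta>, 1)\<close> is not a partition. Those with \<open>b = 1\<close> yield
      the terms with \<open>b = 0\<close> of the sum that is multiplied by \<open>e\<^sub>1\<close>.\<close>
    have c0: "c a 0 = 0" for a
      by (simp add: c_def laplace_def half_laplace_def minor2_def hrow_def complete_sym_simps)
    have c1: "c (a + 1) 1 = elem_sym 1 * schur [a, a]" for a
      unfolding elem_sym_1_eq
      by (simp add: c_def laplace_def half_laplace_def minor2_def hrow_def complete_sym_simps
          schur_2 algebra_simps)
    have c2: "c (a + 2) (b + 2) = elem_sym 1 * schur [a + 1, a + 1, b + 1, b + 1]
        - schur [a + 1, a + 1, b + 1, b + 1, 1]" if "b \<le> a" for a b
    proof -
      have h1: "hrow (-3) 4 = elem_sym 1" unfolding elem_sym_1_eq by (simp add: hrow_def)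
      have "schur [a + 1, a + 1, b + 1, b + 1, 1]
          = elem_sym 1 * schur [a + 1, a + 1, b + 1, b + 1] - c (a + 2) (b + 2)"
        using that unfolding h1[symmetric]
        by (subst schur_5, simp, simp, subst schur_4, simp)
          (simp add: c_def hrow_def complete_sym_simps)
      then show ?thesis by simp
    qed
    have "pair_series 2 c = fps_X ^ 2 * Abs_fps (\<lambda>a. c a 0)
        + (fps_X ^ 4 * Abs_fps (\<lambda>a. c (a + 1) 1)
        + pair_series (4 + 2) (\<lambda>a b. c (a + 2) (b + 2)))"
      by (subst pair_series_peel, subst pair_series_peel) (simp add: numeral_eq_Suc)
    also have "Abs_fps (\<lambda>a. c a 0) = 0" by (rule fps_ext) (simp add: c0)
    also have "Abs_fps (\<lambda>a. c (a + 1) 1) = e * P 0"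
      by (rule fps_ext) (simp only: c1 e_def P_def schur_series_def fps_mult_left_const_nth
          fps_nth_Abs_fps add_0_right)
    also have "pair_series (4 + 2) (\<lambda>a b. c (a + 2) (b + 2)) = fps_X ^ 4 * (e * F4 - F5)"
      unfolding pair_series_shift F4_def F5_def e_def pair_series_const_mult[symmetric]
        pair_series_diff[symmetric]
      by (intro arg_cong2[where f = "(*)"] refl pair_series_cong) (rule c2)
    finally show ?thesis by (simp add: algebra_simps)
  qed
  ultimately have "P 0 * P 1 - fps_X * (P 1 * P 2 - P 0 * P 3) = e * P 0 + (e * F4 - F5)"
    by (metis fps_X_power_mult_cancel)
  moreover have "pair_series 0 (\<lambda>a b. schur [a, a, b, b]) = P 0 + F4"
  proof -
    have "schur [a, a, 0, 0] = schur [a, a]" for a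
      using schur_append_zero[of "[a, a, 0]"] schur_append_zero[of "[a, a]"] by simp
    then show ?thesis
      by (subst pair_series_peel) (simp add: F4_def P_def schur_series_def numeral_2_eq_2)
  qed
  ultimately show ?thesis
    unfolding P_def[symmetric] P0[symmetric] e_def[symmetric] F5_def[symmetric]
    by (simp add: algebra_simps)
qed

text \<open>
  The part of the second identity in which no index is shifted. The coefficient of \<open>p\<^sub>0\<^sup>2\<close> cancels: it
  is \<open>s\<^bsub>(2,2)\<^esub> - e\<^sub>2\<^sup>2 + e\<^sub>1 e\<^sub>3\<close>, the dual Jacobi--Trudi formula, written in terms of the \<open>h\<^sub>i\<close>.
\<close>

lemma two_row_quadratic_relation:
  fixes p0 :: "'a :: comm_ring_1"
  shows "p0 * ((h2\<^sup>2 - h1 * h3) * p0 - (h1 * h2 - h3) * p1 + (h1\<^sup>2 - h2) * p2)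
     + (h1 * p0 - p1)
       * ((h1 ^ 3 - h1 * h2 - h1 * h2 + h3) * p0 - (h1\<^sup>2 - h2) * p1 + h1 * p2 - p3)
     - ((h1\<^sup>2 - h2) * p0 - h1 * p1 + p2)\<^sup>2
   = h2 * (p0 * p2 - p1\<^sup>2) + h1 * (p1 * p2 - p0 * p3) + p1 * p3 - p2\<^sup>2"
  by (simp add: algebra_simps power2_eq_square power3_eq_cube)

text \<open>
  The last row of the matrix for \<open>(\<alpha>, \<alpha>, \<beta>, \<beta>, 2)\<close> is \<open>(0, 0, 1, h\<^sub>1, h\<^sub>2)\<close>, so three folded sums
  contribute. Both sides become quadratic polynomials in the four series
  \<open>\<Sum>\<^sub>k s\<^bsub>(k+d,k)\<^esub> t\<^sup>k\<close>, up to one linear term that appears twice: on the left from the extra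
  term of the series for \<open>(k, k, 2, 2)\<close>, on the right from \<open>\<beta> = -1\<close>.
\<close>

lemma kk22_products_eq_five_row:
  "schur_series (\<lambda>k. [k, k]) * schur_series (\<lambda>k. [k, k, 2, 2])
    - (schur_series (\<lambda>k. [k, k, 1, 1]))\<^sup>2
    + schur_series (\<lambda>k. [k, k, 1]) * schur_series (\<lambda>k. [k, k, 1, 1, 1])
  = pair_series 3 (\<lambda>a b. schur [a + 2, a + 2, b + 2, b + 2, 2])"
proof -
  define P where "P d = schur_series (\<lambda>k. [k + d, k])" for d
  have P0: "P 0 = schur_series (\<lambda>k. [k, k])" by (simp add: P_def)
  define F where "F = pair_series 3 (\<lambda>a b. schur [a + 2, a + 2, b + 2, b + 2, 2])"
  define t where "t = (fps_X :: mfps fps)"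
  define h1 h2 h3 where "h1 = fps_const (complete_sym 1)" and "h2 = fps_const (complete_sym 2)"
    and "h3 = fps_const (complete_sym 3)"
  have M: "minor_series s i j = t ^ (s - i) * P (j - i - 1)" if "i < j" "i \<le> s" for s i j
    using minor_series_eq[OF that] by (simp add: P_def t_def)
  have M0: "Abs_fps (\<lambda>n. pair_minor (int n) 0 (Suc d)) = P d" for d
    using minor_series_eq[of 0 "Suc d" 0] by (simp add: P_def minor_series_def)

  define S1 S11 S111 S22 where "S1 = schur_series (\<lambda>k. [k, k, 1])"
    and "S11 = schur_series (\<lambda>k. [k, k, 1, 1])" and "S111 = schur_series (\<lambda>k. [k, k, 1, 1, 1])"
    and "S22 = schur_series (\<lambda>k. [k, k, 2, 2])"
  have S1: "S1 = h1 * P 0 - P 1"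
    unfolding M0[symmetric] h1_def
      S1_def schur_series_def schur_kk1
    by (rule fps_ext) (simp add: numeral_2_eq_2)
  have S11: "S11 = (h1\<^sup>2 - h2) * P 0 - h1 * P 1 + P 2"
    unfolding M0[symmetric] h1_def h2_def fps_const_power fps_const_sub
      S11_def schur_series_def schur_kk11
    by (rule fps_ext) (simp add: numeral_2_eq_2 numeral_3_eq_3)
  have S111: "S111 = (h1 ^ 3 - h1 * h2 - h1 * h2 + h3) * P 0 - (h1\<^sup>2 - h2) * P 1 + h1 * P 2 - P 3"
    unfolding M0[symmetric] h1_def h2_def h3_def fps_const_power fps_const_sub fps_const_mult
      fps_const_add
      S111_def schur_series_def schur_kk111
    by (rule fps_ext) (simp add: algebra_simps eval_nat_numeral)
  have S22: "t\<^sup>2 * S22 + 1 = t\<^sup>2 * ((h2\<^sup>2 - h1 * h3) * P 0 - (h1 * h2 - h3) * P 1 + (h1\<^sup>2 - h2) * P 2)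
      + t * (h2 * P 0 - h1 * P 1) + P 0"
  proof -
    have "t\<^sup>2 * S22 + 1 = Abs_fps (\<lambda>n. kk22_expansion (int n - 2))"
    proof (rule fps_ext)
      fix n :: nat
      have "n = 0 \<or> n = 1 \<or> n = (n - 2) + 2" by linarith
      then consider "n = 0" | "n = 1" | k where "n = k + 2" by blast
      then show "fps_nth (t\<^sup>2 * S22 + 1) n = fps_nth (Abs_fps (\<lambda>n. kk22_expansion (int n - 2))) n"
        by cases (simp_all add: t_def fps_X_power_mult_nth kk22_expansion_below S22_def schur_series_def
            schur_kk22)
    qed
    also have "\<dots> = (h2\<^sup>2 - h1 * h3) * minor_series 2 0 1 - (h1 * h2 - h3) * minor_series 2 0 2
        + (h1\<^sup>2 - h2) * minor_series 2 0 3 + h2 * minor_series 2 1 2 - h1 * minor_series 2 1 3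
        + minor_series 2 2 3"
      unfolding h1_def h2_def h3_def fps_const_power fps_const_sub fps_const_mult
      by (rule fps_ext) (simp add: kk22_expansion_def minor_series_def)
    finally show ?thesis by (simp add: M) (simp add: algebra_simps eval_nat_numeral)
  qed

  define R where "R a b = complete_sym 2 * laplace (hrow (int a - 1)) (hrow (int a - 2))
        (hrow (int b - 3)) (hrow (int b - 4)) 0 1 2 3
      - complete_sym 1 * laplace (hrow (int a - 1)) (hrow (int a - 2))
        (hrow (int b - 3)) (hrow (int b - 4)) 0 1 2 4
      + laplace (hrow (int a - 1)) (hrow (int a - 2))
        (hrow (int b - 3)) (hrow (int b - 4)) 0 1 3 4" for a b
  define W where "W = h2 * (P 0 * P 2 - (P 1)\<^sup>2) + h1 * (P 1 * P 2 - P 0 * P 3) + P 1 * P 3 - (P 2)\<^sup>2"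
  have "pair_series 2 R = t ^ 3 * P 0 * (P 0 + t * (h2 * P 0 - h1 * P 1)) + t ^ 5 * W"
    unfolding R_def pair_series_add pair_series_diff pair_series_const_mult pair_series_laplace
      h1_def[symmetric] h2_def[symmetric]
    by (simp add: M W_def) (simp add: algebra_simps eval_nat_numeral)
  moreover have "pair_series 2 R = t ^ 3 * P 0 + t ^ 5 * F"
  proof -
    \<comment> \<open>For \<open>\<beta> = 0\<close> and \<open>\<beta> = 1\<close> one of the rows of the pair equals the last row. For
      \<open>\<beta> = -1\<close> the determinant straightens to \<open>s\<^bsub>(\<alpha>,\<alpha>)\<^esub>\<close>.\<close>
    have R0: "R a 0 = pair_minor (int a - 1) 0 1" for a
      by (simp add: R_def laplace_def half_laplace_def minor2_def hrow_def complete_sym_simps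
          pair_minor_def)
    have R1: "R (a + 1) 1 = 0" for a
      by (simp add: R_def laplace_def half_laplace_def minor2_def hrow_def complete_sym_simps
          algebra_simps)
    have R2: "R (a + 2) 2 = 0" for a
      by (simp add: R_def laplace_def half_laplace_def minor2_def hrow_def complete_sym_simps
          algebra_simps)
    have R3: "R (a + 3) (b + 3) = schur [a + 2, a + 2, b + 2, b + 2, 2]" if "b \<le> a" for a b
      using that by (subst schur_5) (simp_all add: R_def hrow_def complete_sym_simps)
    have p2: "pair_series 2 R = t ^ 2 * Abs_fps (\<lambda>a. R a 0)
        + pair_series 4 (\<lambda>a b. R (a + 1) (b + 1))"
      using pair_series_peel[of 2 R] by (simp add: t_def)
    have p4: "pair_series 4 (\<lambda>a b. R (a + 1) (b + 1)) = t ^ 4 * Abs_fps (\<lambda>a. R (a + 1) 1)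
        + pair_series 6 (\<lambda>a b. R (a + 2) (b + 2))"
      using pair_series_peel[of 4 "\<lambda>a b. R (a + 1) (b + 1)"] by (simp add: t_def)
    have p6: "pair_series 6 (\<lambda>a b. R (a + 2) (b + 2)) = t ^ 6 * Abs_fps (\<lambda>a. R (a + 2) 2)
        + pair_series (5 + 3) (\<lambda>a b. R (a + 3) (b + 3))"
      using pair_series_peel[of 6 "\<lambda>a b. R (a + 2) (b + 2)"]
      by (simp add: t_def numeral_2_eq_2 numeral_3_eq_3)
    have "pair_series 2 R = t ^ 2 * Abs_fps (\<lambda>a. R a 0)
        + (t ^ 4 * Abs_fps (\<lambda>a. R (a + 1) 1) + (t ^ 6 * Abs_fps (\<lambda>a. R (a + 2) 2)
        + pair_series (5 + 3) (\<lambda>a b. R (a + 3) (b + 3))))"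
      unfolding p2 p4 p6 ..
    also have "Abs_fps (\<lambda>a. R a 0) = minor_series 1 0 1"
      by (simp add: R0 minor_series_def)
    also have "Abs_fps (\<lambda>a. R (a + 1) 1) = 0" by (rule fps_ext) (simp only: R1 fps_nth_Abs_fps fps_zero_nth)
    also have "Abs_fps (\<lambda>a. R (a + 2) 2) = 0" by (rule fps_ext) (simp only: R2 fps_nth_Abs_fps fps_zero_nth)
    also have "pair_series (5 + 3) (\<lambda>a b. R (a + 3) (b + 3)) = t ^ 5 * F"
      unfolding pair_series_shift F_def t_def
      by (intro arg_cong2[where f = "(*)"] refl pair_series_cong) (rule R3)
    finally show ?thesis by (simp add: M eval_nat_numeral algebra_simps)
  qed
  moreover have "t ^ 3 * P 0 * (P 0 + t * (h2 * P 0 - h1 * P 1)) + t ^ 5 * W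
      = t ^ 3 * P 0 + t ^ 5 * (P 0 * S22 - S11\<^sup>2 + S1 * S111)"
  proof -
    define Y where "Y = (h2\<^sup>2 - h1 * h3) * P 0 - (h1 * h2 - h3) * P 1 + (h1\<^sup>2 - h2) * P 2"
    have "t ^ 3 * P 0 + t ^ 5 * (P 0 * S22 - S11\<^sup>2 + S1 * S111)
        = t ^ 3 * P 0 * (t\<^sup>2 * S22 + 1) + t ^ 5 * (S1 * S111 - S11\<^sup>2)"
      by (simp add: algebra_simps eval_nat_numeral)
    also have "\<dots> = t ^ 3 * P 0 * (P 0 + t * (h2 * P 0 - h1 * P 1))
        + t ^ 5 * (P 0 * Y + S1 * S111 - S11\<^sup>2)"
      unfolding S22 Y_def[symmetric] by (simp add: algebra_simps eval_nat_numeral)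
    also have "P 0 * Y + S1 * S111 - S11\<^sup>2 = W"
      unfolding Y_def S1 S11 S111 W_def by (rule two_row_quadratic_relation)
    finally show ?thesis ..
  qed
  ultimately have "t ^ 5 * (P 0 * S22 - S11\<^sup>2 + S1 * S111) = t ^ 5 * F" by simp
  then have "P 0 * S22 - S11\<^sup>2 + S1 * S111 = F"
    unfolding t_def by (rule fps_X_power_mult_cancel)
  then show ?thesis
    unfolding P0 S1_def S11_def S111_def S22_def F_def .
qed

theorem theorem3p10:
  shows "fps_X * (schur_series (\<lambda>k. [k + 1, k]) * schur_series (\<lambda>k. [k + 2, k])
            - schur_series (\<lambda>k. [k, k]) * schur_series (\<lambda>k. [k + 3, k]))
          - schur_series (\<lambda>k. [k, k]) * schur_series (\<lambda>k. [k + 1, k])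
        = pair_series 2 (\<lambda>a b. schur [a + 1, a + 1, b + 1, b + 1, 1])
          - fps_const (elem_sym 1) * pair_series 0 (\<lambda>a b. schur [a, a, b, b])
      \<and> schur_series (\<lambda>k. [k, k]) * schur_series (\<lambda>k. [k, k, 2, 2])
          - (schur_series (\<lambda>k. [k, k, 1, 1]))\<^sup>2
          + schur_series (\<lambda>k. [k, k, 1]) * schur_series (\<lambda>k. [k, k, 1, 1, 1])
        = pair_series 3 (\<lambda>a b. schur [a + 2, a + 2, b + 2, b + 2, 2])"
  using two_row_products_eq_five_row kk22_products_eq_five_row by blast

end
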